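(* Let $f:\mathbb{R}^n\times\mathbb{R}^m\to\mathbb{R}^n$ and $g:\mathbb{R}^n\times\mathbb{R}^m\to\mathbb{R}^{n\times l}$ be smooth with $f(0,0)=0$, $g(0,0)=0$. Let $k:\mathbb{R}^l\times\mathbb{R}^n\to\mathbb{R}^m$ be smooth with $k(\theta,0)=0$ for all $\theta\in\mathbb{R}^l$. Let $V_\theta,Q_\theta:\mathbb{R}^n\to\mathbb{R}_+$ ($\theta\in\mathbb{R}^l$) be two families of continuous, positive definite and radially unbounded functions such that the mappings $(\theta,x)\mapsto V_\theta(x)$ and $(\theta,x)\mapsto Q_\theta(x)$ are continuous on $\mathbb{R}^l\times\mathbb{R}^n$. Assume: (i) For each $\theta\in\mathbb{R}^l$, $0\in\mathbb{R}^n$ is globally asymptotically stable for $$\dot x=f(x,k(\theta,x))+g(x,k(\theta,x))\theta.\qquad( * )$$ Moreover, for every $\theta\in\mathbb{R}^l$, $x_0\in\mathbb{R}^n$ the solution $x(t)$ of $( * )$ with $x(0)=x_0$ satisfies $V_\theta(x(t))\le Q_\theta(x_0)$ for all $t\ge 0$. (ii) For every non-empty compact set $\Theta\subset\mathbb{R}^l$ and every $M\ge 0$ there exists $R>0$ such that $V_\theta(x)\le M$, $\theta\in\Theta$ imply $|x|\le R$. (iii) $N$ is a positive integer for which the following implication holds: if there exist times $0=\tau_0<\tau_1<\dots<\tau_N$, vectors $\theta,d_0,\dots,d_N\in\mathbb{R}^l$ with $d_i\neq 0$ for $i=0,\dots,N$, and a right differentiable mapping $x\in C^0([0,\tau_N];\mathbb{R}^n)\cap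 C^1([0,\tau_N]\setminus\{\tau_0,\dots,\tau_N\};\mathbb{R}^n)$ satisfying $\dot x(t)=f(x(t),k(\theta+d_i,x(t)))+g(x(t),k(\theta+d_i,x(t)))\theta$ for $t\in[\tau_i,\tau_{i+1})$, $i=0,\dots,N-1$, and $g(x(t),k(\theta+d_j,x(t)))\,d_{i+1}=0$ for all $t\in[\tau_j,\tau_{j+1}]$, $i=0,\dots,N-1$, $j=0,\dots,i$, then $x(t)=0$ for all $t\in[0,\tau_N]$. (iv) For each $\theta\in\mathbb{R}^l$, $0\in\mathbb{R}^n$ is globally exponentially stable for $( * )$, i.e. there exist constants $M_\theta,\omega_\theta>0$ such that for every $x_0\in\mathbb{R}^n$ the solution of $( * )$ with $x(0)=x_0$ satisfies $|x(t)|\le M_\theta\exp(-\omega_\theta t)|x_0|$ for all $t\ge0$. (v) For every non-empty compact set $\Theta\subset\mathbb{R}^l$ there exist constants $K_2>K_1>0$ such that $K_1|x|^2\le V_\theta(x)\le Q_\theta(x)\le K_2|x|^2$ for all $x\in\mathbb{R}^n$, $\theta\in\Theta$. Let $T>0$, let $a:\mathbb{R}^n\to\mathbb{R}_+$ be a continuous, positive definite function with $\sup\{|x|^{-2}a(x):x\in\mathbb{R}^n,\ x\ne0\}<+\infty$, and let $\tilde N>N$ be an integer. Then there exists a family of constants $\tilde M_{\theta,\hat\theta}>0$, parameterized by $\theta\in\mathbb{R}^l$, $\hat\theta\in\mathbb{R}^l$, such that for every $\theta\in\mathbb{R}^l$, $x_0\in\mathbb{R}^n$, $\hat\theta_0\in\mathbb{R}^l$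 the solution of the hybrid closed-loop system (described in the context, with true parameter $\theta$) with initial conditions $x(0)=x_0$, $\hat\theta(0)=\hat\theta_0$ satisfies $$|x(t)|\le\tilde M_{\theta,\hat\theta_0}\exp(-\omega_\theta t)|x_0|\quad\text{for all }t\ge0,$$ where $\omega_\theta$ is the constant from (iv).
   Context: Notation. $|\cdot|$ is the Euclidean norm, a prime denotes transpose, $\mathbb{R}_+=[0,\infty)$, $\mathbb{Z}_+=\{0,1,2,\dots\}$. $V:\mathbb{R}^n\to\mathbb{R}_+$ is positive definite if $V(0)=0$ and $V(x)>0$ for $x\ne0$; a continuous $V$ is radially unbounded if $\{x: V(x)\le M\}$ is compact for every $M>0$. Hybrid closed-loop system. Given the data $f,g,k,V_\theta,Q_\theta,a,T,\tilde N$ and the (constant, unknown to the controller) parameter $\theta\in\mathbb{R}^l$, the plant is $$\dot x=f(x,u)+g(x,u)\theta,\qquad x\in\mathbb{R}^n,\ u\in\mathbb{R}^m.$$ The state $x(t)$ is continuous, and there is a sequence of event times $\tau_0=0<\tau_1<\tau_2<\dots$ such that for all $i\in\mathbb{Z}_+$: (1) Control: for $t\in[\tau_i,\tau_{i+1})$, $u(t)=k(\hat\theta(\tau_i),x(t))$ and $\hat\theta(t)=\hat\theta(\tau_i)$. (2) Event times: $\tau_{i+1}=\min(\tau_i+T,r_i)$, where, if $x(\tau_i)\ne0$, $$r_i=\inf\{t>\tau_i:\ V_{\hat\theta(\tau_i)}(x(t))=Q_{\hat\theta(\tau_i)}(x(\tau_i))+a(x(\tau_i))\}$$ with $x(t)$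 the solution of the plant with $u(t)=k(\hat\theta(\tau_i),x(t))$ ($r_i=+\infty$ if no such $t$ exists), and $r_i=\tau_i+T$ if $x(\tau_i)=0$. (3) Parameter update: let $\mu_{i+1}=\min\{\tau_j:\ j\in\{0,\dots,i\},\ \tau_j\ge\tau_{i+1}-\tilde N T\}$, $$p(t,\sigma)=x(t)-x(\sigma)-\int_\sigma^t f(x(s),u(s))\,ds,\qquad q(t,\sigma)=\int_\sigma^t g(x(s),u(s))\,ds,$$ $$G(\tau_{i+1},\mu_{i+1})=\int_{\mu_{i+1}}^{\tau_{i+1}}\!\int_{\mu_{i+1}}^{\tau_{i+1}}q'(t,\sigma)q(t,\sigma)\,d\sigma\,dt,\qquad Z(\tau_{i+1},\mu_{i+1})=\int_{\mu_{i+1}}^{\tau_{i+1}}\!\int_{\mu_{i+1}}^{\tau_{i+1}}q'(t,\sigma)p(t,\sigma)\,d\sigma\,dt.$$ Then $\hat\theta(\tau_{i+1})$ is the unique minimizer $$\hat\theta(\tau_{i+1})=\arg\min\{|\vartheta-\hat\theta(\tau_i)|^2:\ \vartheta\in\mathbb{R}^l,\ Z(\tau_{i+1},\mu_{i+1})=G(\tau_{i+1},\mu_{i+1})\vartheta\}.$$ *)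

theory Defs
  imports "HOL-Analysis.Analysis"
begin

(* r times continuously differentiable on the whole space: the derivative along every fixed
   direction v is (r-1) times continuously differentiable. On finite-dimensional domains this is
   the usual notion. *)
primrec times_cont_diff ::
  "nat \<Rightarrow> ('a::real_normed_vector \<Rightarrow> 'b::real_normed_vector) \<Rightarrow> bool" where
  "times_cont_diff 0 h \<longleftrightarrow> continuous_on UNIV h"
| "times_cont_diff (Suc r) h \<longleftrightarrow>
     (\<exists>h'. (\<forall>z. (h has_derivative h' z) (at z)) \<and> (\<forall>v. times_cont_diff r (\<lambda>z. h' z v)))"

definition smooth_map :: "('a::real_normed_vector \<Rightarrow> 'b::real_normed_vector) \<Rightarrow> bool" where
  "smooth_map h \<longleftrightarrow> (\<forall>r. times_cont_diff r h)"

definition positive_definite :: "('a::real_normed_vector \<Rightarrow> real) \<Rightarrow> bool" where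
  "positive_definite W \<longleftrightarrow> W 0 = 0 \<and> (\<forall>x. x \<noteq> 0 \<longrightarrow> W x > 0)"

definition radially_unbounded :: "('a::real_normed_vector \<Rightarrow> real) \<Rightarrow> bool" where
  "radially_unbounded W \<longleftrightarrow> (\<forall>M>0. compact {x. W x \<le> M})"

(* The derivative is taken within J, hence one-sided at end points belonging to J. *)
definition ode_solution ::
  "('a::real_normed_vector \<Rightarrow> 'a) \<Rightarrow> real set \<Rightarrow> (real \<Rightarrow> 'a) \<Rightarrow> bool" where
  "ode_solution F J x \<longleftrightarrow> (\<forall>t\<in>J. (x has_vector_derivative F (x t)) (at t within J))"

(* Forward completeness, Lyapunov stability and global attractivity of the origin. The definition is
   meant for vector fields with unique solutions (e.g. locally Lipschitz ones), so that the solutions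
   on [0,oo) occurring below are all maximal solutions. *)
definition globally_asymptotically_stable :: "('a::real_normed_vector \<Rightarrow> 'a) \<Rightarrow> bool" where
  "globally_asymptotically_stable F \<longleftrightarrow>
     (\<forall>x0. \<exists>x. ode_solution F {0..} x \<and> x 0 = x0) \<and>
     (\<forall>\<epsilon>>0. \<exists>\<delta>>0. \<forall>x. ode_solution F {0..} x \<and> norm (x 0) < \<delta> \<longrightarrow> (\<forall>t\<ge>0. norm (x t) < \<epsilon>)) \<and>
     (\<forall>x. ode_solution F {0..} x \<longrightarrow> (x \<longlongrightarrow> 0) at_top)"

(* Right-hand side of the plant with true parameter \<theta> under the feedback u = k(\<eta>,x), where \<eta> is the
   parameter value used by the controller. *)
definition closed_loop ::
  "(real^'n \<Rightarrow> real^'m \<Rightarrow> real^'n) \<Rightarrow> (real^'n \<Rightarrow> real^'m \<Rightarrow> real^'l^'n) \<Rightarrow>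
   (real^'l \<Rightarrow> real^'n \<Rightarrow> real^'m) \<Rightarrow> real^'l \<Rightarrow> real^'l \<Rightarrow> real^'n \<Rightarrow> real^'n" where
  "closed_loop f g k \<theta> \<eta> x = f x (k \<eta> x) + g x (k \<eta> x) *v \<theta>"

(* r_i for \<tau>_i = s, x(\<tau>_i) = \<xi> and parameter estimate \<eta>. The solution y starting from \<xi> at time s need
   not exist for all times, so t ranges over the times up to which it exists. In ereal the infimum
   of the empty set is \<infinity>. *)
definition trigger_time ::
  "(real^'n \<Rightarrow> real^'m \<Rightarrow> real^'n) \<Rightarrow> (real^'n \<Rightarrow> real^'m \<Rightarrow> real^'l^'n) \<Rightarrow>
   (real^'l \<Rightarrow> real^'n \<Rightarrow> real^'m) \<Rightarrow> (real^'l \<Rightarrow> real^'n \<Rightarrow> real) \<Rightarrow>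
   (real^'l \<Rightarrow> real^'n \<Rightarrow> real) \<Rightarrow> (real^'n \<Rightarrow> real) \<Rightarrow> real \<Rightarrow>
   real^'l \<Rightarrow> real^'l \<Rightarrow> real \<Rightarrow> real^'n \<Rightarrow> ereal" where
  "trigger_time f g k V Q a T \<theta> \<eta> s \<xi> =
     (if \<xi> = 0 then ereal (s + T)
      else Inf (ereal ` {t. s < t \<and>
             (\<exists>y. ode_solution (closed_loop f g k \<theta> \<eta>) {s..t} y \<and> y s = \<xi> \<and>
                  V \<eta> (y t) = Q \<eta> \<xi> + a \<xi>)}))"

(* The interval integral LBINT is oriented: it changes sign when its bounds are exchanged, which
   matters because both t < \<sigma> and \<sigma> < t occur in G and Z. *)
definition p_reg ::
  "(real^'n \<Rightarrow> real^'m \<Rightarrow> real^'n) \<Rightarrow> (real \<Rightarrow> real^'n) \<Rightarrow> (real \<Rightarrow> real^'m) \<Rightarrow>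
   real \<Rightarrow> real \<Rightarrow> real^'n" where
  "p_reg f x u t \<sigma> = x t - x \<sigma> - (LBINT s=ereal \<sigma>..ereal t. f (x s) (u s))"

definition q_reg ::
  "(real^'n \<Rightarrow> real^'m \<Rightarrow> real^'l^'n) \<Rightarrow> (real \<Rightarrow> real^'n) \<Rightarrow> (real \<Rightarrow> real^'m) \<Rightarrow>
   real \<Rightarrow> real \<Rightarrow> real^'l^'n" where
  "q_reg g x u t \<sigma> = (LBINT s=ereal \<sigma>..ereal t. g (x s) (u s))"

definition G_mat ::
  "(real^'n \<Rightarrow> real^'m \<Rightarrow> real^'l^'n) \<Rightarrow> (real \<Rightarrow> real^'n) \<Rightarrow> (real \<Rightarrow> real^'m) \<Rightarrow>
   real \<Rightarrow> real \<Rightarrow> real^'l^'l" where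
  "G_mat g x u \<tau>' \<mu> =
     (LBINT t=ereal \<mu>..ereal \<tau>'. (LBINT \<sigma>=ereal \<mu>..ereal \<tau>'.
        transpose (q_reg g x u t \<sigma>) ** q_reg g x u t \<sigma>))"

definition Z_vec ::
  "(real^'n \<Rightarrow> real^'m \<Rightarrow> real^'n) \<Rightarrow> (real^'n \<Rightarrow> real^'m \<Rightarrow> real^'l^'n) \<Rightarrow>
   (real \<Rightarrow> real^'n) \<Rightarrow> (real \<Rightarrow> real^'m) \<Rightarrow> real \<Rightarrow> real \<Rightarrow> real^'l" where
  "Z_vec f g x u \<tau>' \<mu> =
     (LBINT t=ereal \<mu>..ereal \<tau>'. (LBINT \<sigma>=ereal \<mu>..ereal \<tau>'.
        transpose (q_reg g x u t \<sigma>) *v p_reg f x u t \<sigma>))"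

(* \<mu>_{i+1} *)
definition window_start :: "real \<Rightarrow> nat \<Rightarrow> (nat \<Rightarrow> real) \<Rightarrow> nat \<Rightarrow> real" where
  "window_start T N' \<tau> i = Min {\<tau> j | j. j \<le> i \<and> \<tau> j \<ge> \<tau> (Suc i) - real N' * T}"

(* Solutions of the hybrid closed-loop system with true parameter \<theta>, state x, parameter estimate \<eta>,
   input u and event times \<tau>. The signals are constrained on [0, sup_i \<tau>_i) only, so that
   sup_i \<tau>_i = \<infinity> is not built into the notion of a solution. The derivative of x is one-sided at
   event times. The last clause determines the estimate uniquely, because it minimizes the distance
   to a point over an affine subspace. *)
definition hybrid_solution ::
  "(real^'n \<Rightarrow> real^'m \<Rightarrow> real^'n) \<Rightarrow> (real^'n \<Rightarrow> real^'m \<Rightarrow> real^'l^'n) \<Rightarrow>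
   (real^'l \<Rightarrow> real^'n \<Rightarrow> real^'m) \<Rightarrow> (real^'l \<Rightarrow> real^'n \<Rightarrow> real) \<Rightarrow>
   (real^'l \<Rightarrow> real^'n \<Rightarrow> real) \<Rightarrow> (real^'n \<Rightarrow> real) \<Rightarrow> real \<Rightarrow> nat \<Rightarrow> real^'l \<Rightarrow>
   (real \<Rightarrow> real^'n) \<Rightarrow> (real \<Rightarrow> real^'l) \<Rightarrow> (real \<Rightarrow> real^'m) \<Rightarrow> (nat \<Rightarrow> real) \<Rightarrow> bool" where
  "hybrid_solution f g k V Q a T N' \<theta> x \<eta> u \<tau> \<longleftrightarrow>
     \<tau> 0 = 0 \<and> (\<forall>i. \<tau> i < \<tau> (Suc i)) \<and>
     (\<forall>i. continuous_on {0..\<tau> i} x) \<and>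
     (\<forall>i. \<forall>t\<in>{\<tau> i..<\<tau> (Suc i)}.
        (x has_vector_derivative f (x t) (u t) + g (x t) (u t) *v \<theta>)
          (at t within {\<tau> i..<\<tau> (Suc i)}) \<and>
        u t = k (\<eta> (\<tau> i)) (x t) \<and> \<eta> t = \<eta> (\<tau> i)) \<and>
     (\<forall>i. ereal (\<tau> (Suc i)) =
        min (ereal (\<tau> i + T)) (trigger_time f g k V Q a T \<theta> (\<eta> (\<tau> i)) (\<tau> i) (x (\<tau> i)))) \<and>
     (\<forall>i. is_arg_min (\<lambda>\<zeta>. (norm (\<zeta> - \<eta> (\<tau> i)))\<^sup>2)
        (\<lambda>\<zeta>. Z_vec f g x u (\<tau> (Suc i)) (window_start T N' \<tau> i) =
             G_mat g x u (\<tau> (Suc i)) (window_start T N' \<tau> i) *v \<zeta>)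
        (\<eta> (\<tau> (Suc i))))"

end

theory Submission
  imports Defs
begin

text \<open>
  The true parameter satisfies the linear equation of every least-squares problem, because integrating
  the plant gives \<open>p = q \<theta>\<close> (\<open>true_parameter_solves_normal_equation\<close>). The update therefore projects the
  old estimate onto an affine subspace through \<open>\<theta>\<close>: the error never grows, and the error that remains
  lies in the kernel of the Gramian, which means that the regressor annihilates it on the whole window
  (\<open>gramian_kernel\<close>). If \<open>x 0 \<noteq> 0\<close> and the estimate were wrong at all of the events \<open>\<tau> 0, \<dots>, \<tau> N\<close>, then
  \<open>N\<close> such invisible errors would contradict hypothesis (iii); so from \<open>\<tau> N \<le> N T\<close> on the estimate is exact
  (\<open>finite_time_identification\<close>).

  Up to \<open>\<tau> N\<close> the event rule keeps the state under control. Within a sampling interval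
  \<open>V \<le> Q (x (\<tau> i)) + a (x (\<tau> i))\<close> (\<open>hybrid_solution_level_bound\<close>), and by the quadratic bounds (v), which are
  uniform over the compact ball that contains all estimates, the norm grows at most by a factor \<open>C\<close> per
  interval. After \<open>\<tau> N\<close> the level is never hit (\<open>certainty_equivalence_no_trigger\<close>); hence events are
  \<open>T\<close> apart, time goes to infinity, and the state follows a nominal solution
  (\<open>hybrid_solution_follows_nominal\<close>), which decays at the rate \<open>\<omega> \<theta>\<close>. The delay costs the factor
  \<open>exp (\<omega> \<theta> N T)\<close>. If \<open>x 0 = 0\<close>, the growth bound already gives \<open>x = 0\<close>.

  Existence of hybrid solutions (\<open>hybrid_solution_exists\<close>) rests on the Picard theorem for vector fields
  truncated outside of a ball: until the trigger the state stays in a sublevel set of \<open>V\<close>, so that the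
  truncation is not felt.
\<close>

section \<open>Lipschitz continuity on balls\<close>

text \<open>
  On a Euclidean space this is local Lipschitz continuity. The form with balls hands over one
  constant for a whole compact set of states, which is what uniqueness and truncation need.
\<close>

definition lipschitz_on_balls ::
  "('a::real_normed_vector \<Rightarrow> 'b::real_normed_vector) \<Rightarrow> bool" where
  "lipschitz_on_balls h \<longleftrightarrow> (\<forall>R. \<exists>L. L-lipschitz_on (cball 0 R) h)"

lemma lipschitz_on_ballsE:
  assumes "lipschitz_on_balls h"
  obtains L where "L > 0" "L-lipschitz_on (cball 0 R) h"
proof -
  obtain L where "L-lipschitz_on (cball 0 R) h"
    using assms by (auto simp: lipschitz_on_balls_def)
  then have "(max L 1)-lipschitz_on (cball 0 R) h"
    by (rule lipschitz_on_le) simp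
  then show thesis
    using that[of "max L 1"] by simp
qed

lemma lipschitz_on_balls_imp_continuous_on:
  fixes h :: "'a::real_normed_vector \<Rightarrow> 'b::real_normed_vector"
  assumes "lipschitz_on_balls h"
  shows "continuous_on S h"
proof (rule continuous_at_imp_continuous_on, rule ballI)
  fix x :: 'a
  obtain L where L: "L-lipschitz_on (cball 0 (norm x + 1)) h"
    using assms by (auto simp: lipschitz_on_balls_def)
  have "x \<in> ball 0 (norm x + 1)"
    by simp
  moreover have "continuous_on (ball 0 (norm x + 1)) h"
    using lipschitz_on_continuous_on[OF L] by (rule continuous_on_subset) auto
  ultimately show "isCont h x"
    using continuous_on_eq_continuous_at open_ball by blast
qed

lemma lipschitz_on_balls_bounded:
  assumes "lipschitz_on_balls h"
  obtains B where "\<And>x. x \<in> cball 0 R \<Longrightarrow> norm (h x) \<le> B"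
proof -
  obtain L where L: "L > 0" "L-lipschitz_on (cball 0 R) h"
    using assms by (rule lipschitz_on_ballsE)
  have "norm (h x) \<le> norm (h 0) + L * R" if x: "x \<in> cball 0 R" for x
  proof -
    have "0 \<le> R"
      using x norm_ge_zero[of x] by (auto simp del: norm_ge_zero)
    then have "dist (h x) (h 0) \<le> L * dist x 0"
      by (intro lipschitz_onD[OF L(2)] x) auto
    also have "\<dots> \<le> L * R"
      using x L(1) by (auto intro: mult_left_mono)
    finally show ?thesis
      using norm_triangle_sub[of "h x" "h 0"] by (simp add: dist_norm)
  qed
  then show thesis by (rule that)
qed

text \<open>
  The derivative is known to be continuous only along each fixed direction. Expanding a direction in
  the finite basis bounds the operator norm on a ball by the sum of the suprema along the basis
  vectors, and the mean value inequality on the convex ball does the rest.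
\<close>

lemma smooth_map_imp_lipschitz_on_balls:
  fixes h :: "'a::euclidean_space \<Rightarrow> 'b::real_normed_vector"
  assumes "smooth_map h"
  shows "lipschitz_on_balls h"
  unfolding lipschitz_on_balls_def
proof
  fix R :: real
  have "times_cont_diff (Suc 0) h"
    using assms unfolding smooth_map_def by (rule spec)
  then obtain h' where deriv: "\<And>z. (h has_derivative h' z) (at z)"
    and cont: "\<And>v. continuous_on UNIV (\<lambda>z. h' z v)"
    unfolding times_cont_diff.simps by blast
  have "\<exists>B. \<forall>z\<in>cball 0 R. norm (h' z b) \<le> B" for b
  proof -
    have "compact ((\<lambda>z. h' z b) ` cball 0 R)"
      by (intro compact_continuous_image continuous_on_subset[OF cont] compact_cball) auto
    then have "bounded ((\<lambda>z. h' z b) ` cball 0 R)"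
      by (rule compact_imp_bounded)
    then show ?thesis
      by (simp add: bounded_iff)
  qed
  then obtain B where B: "\<And>b z. z \<in> cball 0 R \<Longrightarrow> norm (h' z b) \<le> B b"
    by metis
  define C where "C = max 0 (\<Sum>b\<in>Basis. B b)"
  have onorm: "onorm (h' z) \<le> C" if z: "z \<in> cball 0 R" for z
  proof (rule onorm_bound)
    interpret lin: linear "h' z"
      using deriv has_derivative_linear by blast
    fix v :: 'a
    have "norm (h' z v) = norm (\<Sum>b\<in>Basis. (v \<bullet> b) *\<^sub>R h' z b)"
      by (metis (no_types, lifting) euclidean_representation lin.scale lin.sum sum.cong)
    also have "\<dots> \<le> (\<Sum>b\<in>Basis. \<bar>v \<bullet> b\<bar> * norm (h' z b))"
      by (rule order_trans[OF norm_sum]) simp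
    also have "\<dots> \<le> (\<Sum>b\<in>Basis. norm v * B b)"
      by (intro sum_mono mult_mono B z) (auto intro: Basis_le_norm)
    also have "\<dots> = (\<Sum>b\<in>Basis. B b) * norm v"
      by (simp add: sum_distrib_left mult.commute)
    also have "\<dots> \<le> C * norm v"
      by (intro mult_right_mono) (auto simp: C_def)
    finally show "norm (h' z v) \<le> C * norm v" .
  qed (simp add: C_def)
  have "C-lipschitz_on (cball 0 R) h"
  proof (rule lipschitz_onI)
    fix x y :: 'a assume xy: "x \<in> cball 0 R" "y \<in> cball 0 R"
    show "dist (h x) (h y) \<le> C * dist x y"
      unfolding dist_norm
      by (rule differentiable_bound[OF convex_cball has_derivative_at_withinI[OF deriv] onorm xy])
  qed (simp add: C_def)
  then show "\<exists>L. L-lipschitz_on (cball 0 R) h" ..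
qed

lemma lipschitz_on_balls_compose:
  assumes h: "lipschitz_on_balls h" and w: "lipschitz_on_balls w"
  shows "lipschitz_on_balls (\<lambda>x. w (h x))"
  unfolding lipschitz_on_balls_def
proof
  fix R
  obtain B where B: "\<And>x. x \<in> cball 0 R \<Longrightarrow> norm (h x) \<le> B"
    using lipschitz_on_balls_bounded[OF h] by blast
  obtain L1 where L1: "L1-lipschitz_on (cball 0 R) h"
    using h by (auto simp: lipschitz_on_balls_def)
  obtain L2 where L2: "L2-lipschitz_on (cball 0 B) w"
    using w by (auto simp: lipschitz_on_balls_def)
  have "L2-lipschitz_on (h ` cball 0 R) w"
    using L2 by (rule lipschitz_on_subset) (use B in auto)
  then show "\<exists>L. L-lipschitz_on (cball 0 R) (\<lambda>x. w (h x))"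
    using lipschitz_on_compose2[OF L1] by blast
qed

lemma lipschitz_on_balls_Pair:
  assumes "lipschitz_on_balls h" "lipschitz_on_balls w"
  shows "lipschitz_on_balls (\<lambda>x. (h x, w x))"
  unfolding lipschitz_on_balls_def
proof
  fix R
  obtain L1 L2 where "L1-lipschitz_on (cball 0 R) h" "L2-lipschitz_on (cball 0 R) w"
    using assms unfolding lipschitz_on_balls_def by fast
  then show "\<exists>L. L-lipschitz_on (cball 0 R) (\<lambda>x. (h x, w x))"
    using lipschitz_on_Pair by blast
qed

lemma lipschitz_on_balls_add:
  assumes "lipschitz_on_balls h" "lipschitz_on_balls w"
  shows "lipschitz_on_balls (\<lambda>x. h x + w x)"
  unfolding lipschitz_on_balls_def
proof
  fix R
  obtain L1 L2 where "L1-lipschitz_on (cball 0 R) h" "L2-lipschitz_on (cball 0 R) w"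
    using assms unfolding lipschitz_on_balls_def by fast
  then show "\<exists>L. L-lipschitz_on (cball 0 R) (\<lambda>x. h x + w x)"
    using lipschitz_on_add by blast
qed

lemma lipschitz_on_balls_bounded_linear:
  assumes "bounded_linear w"
  shows "lipschitz_on_balls w"
  using assms unfolding lipschitz_on_balls_def
  by (meson bounded_linear.lipschitz_boundE lipschitz_on_subset subset_UNIV)

lemma lipschitz_on_balls_const: "lipschitz_on_balls (\<lambda>x. c)"
  unfolding lipschitz_on_balls_def by (rule allI, rule exI[of _ 0], rule lipschitz_on_constant)

text \<open>
  Solutions only need Lipschitz continuity; every later use of smoothness goes through this lemma.
\<close>

lemma feedback_lipschitz_on_balls:
  fixes k :: "'l::euclidean_space \<Rightarrow> 'n::euclidean_space \<Rightarrow> 'm::euclidean_space"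
    and h :: "'n \<Rightarrow> 'm \<Rightarrow> 'b::real_normed_vector"
  assumes "smooth_map (\<lambda>(\<theta>, x). k \<theta> x)" and "smooth_map (\<lambda>(x, u). h x u)"
  shows "lipschitz_on_balls (\<lambda>x. h x (k \<eta> x))"
proof -
  have ident: "lipschitz_on_balls (\<lambda>x::'n. x)"
    by (rule lipschitz_on_balls_bounded_linear) (rule bounded_linear_ident)
  have k: "lipschitz_on_balls (\<lambda>x. k \<eta> x)"
    using lipschitz_on_balls_compose[OF lipschitz_on_balls_Pair[OF lipschitz_on_balls_const[of \<eta>] ident]
        smooth_map_imp_lipschitz_on_balls[OF assms(1)]] by simp
  show ?thesis
    using lipschitz_on_balls_compose[OF lipschitz_on_balls_Pair[OF ident k]
        smooth_map_imp_lipschitz_on_balls[OF assms(2)]] by simp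
qed

lemma bounded_linear_matrix_vector_mult_left:
  "bounded_linear (\<lambda>A::real^'l^'n. A *v v)"
  by (simp add: linear_conv_bounded_linear[symmetric] linear_iff
      matrix_vector_mult_add_rdistrib scaleR_matrix_vector_assoc)

lemma closed_loop_lipschitz_on_balls:
  assumes "smooth_map (\<lambda>(x, u). f x u)" "smooth_map (\<lambda>(x, u). g x u)"
    and "smooth_map (\<lambda>(\<theta>, x). k \<theta> x)"
  shows "lipschitz_on_balls (closed_loop f g k \<theta> \<eta>)"
  unfolding closed_loop_def[abs_def]
  by (intro lipschitz_on_balls_add feedback_lipschitz_on_balls assms
      lipschitz_on_balls_compose[OF feedback_lipschitz_on_balls[OF assms(3) assms(2)]]
      lipschitz_on_balls_bounded_linear bounded_linear_matrix_vector_mult_left)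

section \<open>Ordinary differential equations with Lipschitz right-hand side\<close>

lemma has_vector_derivative_halfopen_imp_at:
  assumes "(x has_vector_derivative D) (at t within {a..<b})" "a < t" "t < (b::real)"
  shows "(x has_vector_derivative D) (at t)"
proof -
  have "(x has_vector_derivative D) (at t within {a<..<b})"
    using assms(1) by (rule has_vector_derivative_within_subset) auto
  then show ?thesis
    using assms(2,3) by (simp add: at_within_open[of t "{a<..<b}"])
qed

text \<open>
  Gronwall's argument: \<open>exp (- 2 L t) |x t - y t|\<^sup>2\<close> is nonincreasing when \<open>L\<close> is a Lipschitz
  constant on a ball containing both trajectories. The equation is required on the half-open interval
  only, because at the end of a sampling interval the input may jump.
\<close>

lemma ode_solution_unique:
  fixes F :: "'a::euclidean_space \<Rightarrow> 'a"
  assumes F: "lipschitz_on_balls F"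
    and x: "continuous_on {a..b} x" "ode_solution F {a..<b} x"
    and y: "continuous_on {a..b} y" "ode_solution F {a..<b} y"
    and init: "x a = y a" and t: "t \<in> {a..b}"
  shows "x t = y t"
proof -
  have "bounded (x ` {a..b} \<union> y ` {a..b})"
    using x(1) y(1) by (simp add: compact_imp_bounded compact_continuous_image)
  then obtain R where R: "x ` {a..b} \<union> y ` {a..b} \<subseteq> cball 0 R"
    using bounded_subset_ballD ball_subset_cball by (meson order_trans)
  obtain L where L: "L > 0" "L-lipschitz_on (cball 0 R) F"
    using F by (rule lipschitz_on_ballsE)
  define \<phi> where "\<phi> = (\<lambda>s. exp (- (2 * L) * s) * ((x s - y s) \<bullet> (x s - y s)))"
  have cont: "continuous_on {a..b} \<phi>"
    unfolding \<phi>_def by (intro continuous_intros x(1) y(1))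
  have "\<exists>D. DERIV \<phi> s :> D \<and> D \<le> 0" if s: "a < s" "s < t" for s
  proof -
    have sb: "s \<in> {a..<b}" "s \<in> {a..b}"
      using s t by auto
    have dx: "(x has_vector_derivative F (x s)) (at s)" "(y has_vector_derivative F (y s)) (at s)"
      using x(2) y(2) sb(1) s t unfolding ode_solution_def
      by (auto intro!: has_vector_derivative_halfopen_imp_at[of _ _ s a b])
    let ?D = "exp (- (2 * L) * s) * (2 * ((x s - y s) \<bullet> (F (x s) - F (y s))))
      - 2 * L * exp (- (2 * L) * s) * ((x s - y s) \<bullet> (x s - y s))"
    have inner: "((\<lambda>s. (x s - y s) \<bullet> (x s - y s)) has_real_derivative
        2 * ((x s - y s) \<bullet> (F (x s) - F (y s)))) (at s)"
      using bounded_bilinear.has_vector_derivative[OF bounded_bilinear_inner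
          has_vector_derivative_diff[OF dx] has_vector_derivative_diff[OF dx]]
      by (simp add: has_real_derivative_iff_has_vector_derivative inner_commute)
    have e: "((\<lambda>s. exp (- (2 * L) * s)) has_real_derivative - (2 * L) * exp (- (2 * L) * s)) (at s)"
      by (auto intro!: derivative_eq_intros)
    have D: "DERIV \<phi> s :> ?D"
      unfolding \<phi>_def using DERIV_mult[OF e inner] by (simp add: algebra_simps)
    have "(x s - y s) \<bullet> (F (x s) - F (y s)) \<le> norm (x s - y s) * norm (F (x s) - F (y s))"
      by (rule norm_cauchy_schwarz)
    also have "\<dots> \<le> norm (x s - y s) * (L * norm (x s - y s))"
      using lipschitz_onD[OF L(2), of "x s" "y s"] R sb(2)
      by (intro mult_left_mono) (auto simp: dist_norm image_subset_iff)
    also have "\<dots> = L * ((x s - y s) \<bullet> (x s - y s))"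
      by (simp add: dot_square_norm power2_eq_square)
    finally have "?D \<le> exp (- (2 * L) * s) * (2 * (L * ((x s - y s) \<bullet> (x s - y s))))
        - 2 * L * exp (- (2 * L) * s) * ((x s - y s) \<bullet> (x s - y s))"
      by (intro diff_right_mono mult_left_mono) auto
    then show ?thesis
      using D by (intro exI[of _ ?D]) (auto simp: algebra_simps)
  qed
  then have "\<phi> t \<le> \<phi> a"
    using t continuous_on_subset[OF cont, of "{a..t}"]
    by (intro DERIV_nonpos_imp_decreasing_open[of a t]) auto
  then have "(x t - y t) \<bullet> (x t - y t) \<le> 0"
    by (simp add: \<phi>_def init mult_le_0_iff)
  then show ?thesis
    by (metis inner_ge_zero inner_eq_zero_iff order_antisym right_minus_eq)
qed

text \<open>
  Picard iteration. The fixed point is sought for \<open>z t = exp (- 2 L t) y t\<close> instead of \<open>y\<close>: in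
  this weighted norm the Picard operator contracts by the factor \<open>1 / 2\<close> on intervals of any
  length, so that no solutions on short intervals have to be pasted together. Bounded continuous
  functions live on the whole line; they are made constant outside of the interval.
\<close>

lemma global_lipschitz_ode_solution_exists:
  fixes F :: "'a::euclidean_space \<Rightarrow> 'a"
  assumes F: "L-lipschitz_on UNIV F" and L: "L > 0" and T: "0 \<le> T"
  shows "\<exists>y. y 0 = \<xi> \<and> ode_solution F {0..T} y"
proof -
  define w :: "(real \<Rightarrow>\<^sub>C 'a) \<Rightarrow> real \<Rightarrow> 'a" where
    "w = (\<lambda>z s. F (exp (2 * L * s) *\<^sub>R apply_bcontfun z s))"
  define \<psi> :: "(real \<Rightarrow>\<^sub>C 'a) \<Rightarrow> real \<Rightarrow> 'a" where
    "\<psi> = (\<lambda>z t. exp (- (2 * L) * t) *\<^sub>R (\<xi> + integral {0..t} (w z)))"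
  have Fcont: "continuous_on UNIV F"
    using F by (rule lipschitz_on_continuous_on)
  have wcont: "continuous_on S (w z)" for S z
    unfolding w_def
    by (intro continuous_on_compose2[OF Fcont] continuous_intros) auto
  have wint: "w z integrable_on {b..c}" for z b c
    by (intro integrable_continuous_real wcont)
  have \<psi>cont: "continuous_on (cbox 0 T) (\<psi> z)" for z
    unfolding \<psi>_def cbox_interval
    by (intro continuous_intros indefinite_integral_continuous_1 wint)
  have "\<exists>\<Phi> :: real \<Rightarrow>\<^sub>C 'a. \<forall>t. apply_bcontfun \<Phi> t = \<psi> z (clamp 0 T t)" for z
    using continuous_on_cbox_bcontfunE[OF \<psi>cont] by (metis (no_types, lifting))
  then obtain \<Phi> :: "(real \<Rightarrow>\<^sub>C 'a) \<Rightarrow> (real \<Rightarrow>\<^sub>C 'a)"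
    where \<Phi>: "\<And>z t. apply_bcontfun (\<Phi> z) t = \<psi> z (clamp 0 T t)"
    by metis
  have contr: "norm (\<psi> z t - \<psi> v t) \<le> 1 / 2 * dist z v" if t: "0 \<le> t" for z v t
  proof -
    have exp_int: "((\<lambda>s. L * dist z v * exp (2 * L * s)) has_integral
        dist z v / 2 * exp (2 * L * t) - dist z v / 2 * exp (2 * L * 0)) {0..t}"
      using t L
      by (intro fundamental_theorem_of_calculus)
        (auto intro!: derivative_eq_intros simp: has_real_derivative_iff_has_vector_derivative[symmetric])
    have "norm (\<psi> z t - \<psi> v t) = exp (- (2 * L) * t) * norm (integral {0..t} (\<lambda>s. w z s - w v s))"
      using wint by (simp add: \<psi>_def integral_diff flip: scaleR_diff_right)
    also have "norm (integral {0..t} (\<lambda>s. w z s - w v s))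
        \<le> integral {0..t} (\<lambda>s. L * dist z v * exp (2 * L * s))"
    proof (rule integral_norm_bound_integral)
      show "(\<lambda>s. w z s - w v s) integrable_on {0..t}"
        by (intro integrable_diff wint)
      fix s
      have "norm (w z s - w v s) \<le> L * norm (exp (2 * L * s) *\<^sub>R apply_bcontfun z s
          - exp (2 * L * s) *\<^sub>R apply_bcontfun v s)"
        using lipschitz_onD[OF F] by (simp add: w_def dist_norm)
      also have "\<dots> = L * (exp (2 * L * s) * dist (apply_bcontfun z s) (apply_bcontfun v s))"
        by (simp add: dist_norm flip: scaleR_diff_right)
      also have "\<dots> \<le> L * (exp (2 * L * s) * dist z v)"
        using L by (intro mult_left_mono dist_bounded) auto
      finally show "norm (w z s - w v s) \<le> L * dist z v * exp (2 * L * s)"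
        by (simp add: mult_ac)
    qed (use exp_int in blast)
    also have "\<dots> \<le> dist z v / 2 * exp (2 * L * t)"
      unfolding integral_unique[OF exp_int] by simp
    finally show ?thesis
      by (simp add: mult_left_mono exp_minus divide_simps)
  qed
  have "dist (\<Phi> z) (\<Phi> v) \<le> 1 / 2 * dist z v" for z v
  proof (rule dist_bound)
    fix t :: real
    have "clamp 0 T t \<in> cbox 0 T"
      using T by (intro clamp_in_interval) simp
    then show "dist (\<Phi> z t) (\<Phi> v t) \<le> 1 / 2 * dist z v"
      using contr[of "clamp 0 T t" z v] by (simp add: \<Phi> dist_norm)
  qed
  then obtain z where z: "\<Phi> z = z"
    using banach_fix_type[of "1 / 2" \<Phi>] by auto
  define y where "y = (\<lambda>t. \<xi> + integral {0..t} (w z))"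
  have y: "exp (2 * L * t) *\<^sub>R apply_bcontfun z t = y t" if "t \<in> {0..T}" for t
  proof -
    have "apply_bcontfun z t = \<psi> z t"
      using that \<Phi>[of z t] z by simp
    then show ?thesis
      by (simp add: \<psi>_def y_def flip: exp_add)
  qed
  have "(y has_vector_derivative F (y t)) (at t within {0..T})" if t: "t \<in> {0..T}" for t
  proof -
    have "(y has_vector_derivative w z t) (at t within {0..T})"
      unfolding y_def
      using has_vector_derivative_add[OF has_vector_derivative_const[of \<xi>]
          integral_has_vector_derivative[OF wcont t]]
      by simp
    then show ?thesis
      using y[OF t] by (simp add: w_def)
  qed
  then show ?thesis
    by (intro exI[of _ y]) (auto simp: y_def ode_solution_def)
qed

section \<open>The sampled loop between two events\<close>

lemma ode_solution_subset:
  "ode_solution F J x \<Longrightarrow> J' \<subseteq> J \<Longrightarrow> ode_solution F J' x"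
  unfolding ode_solution_def by (blast intro: has_vector_derivative_within_subset)

lemma ode_solution_imp_continuous_on: "ode_solution F J x \<Longrightarrow> continuous_on J x"
  unfolding ode_solution_def continuous_on_eq_continuous_within
  by (blast intro: has_vector_derivative_continuous)

lemma ode_solution_shift:
  assumes "ode_solution F ((\<lambda>r. r + s) ` J) z"
  shows "ode_solution F J (\<lambda>r. z (r + s))"
  unfolding ode_solution_def
proof
  fix r assume r: "r \<in> J"
  have "((\<lambda>r. r + s) has_vector_derivative 1) (at r within J)"
    by (auto intro!: derivative_eq_intros)
  moreover have "(z has_vector_derivative F (z (r + s))) (at (r + s) within (\<lambda>r. r + s) ` J)"
    using assms r by (auto simp: ode_solution_def)
  ultimately show "((\<lambda>r. z (r + s)) has_vector_derivative F (z (r + s))) (at r within J)"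
    using vector_diff_chain_within by (fastforce simp: o_def)
qed

text \<open>
  Existence of the flow up to the next event, although the mismatched closed loop may blow up in
  finite time. Before the trigger the state lies in a bounded sublevel set of \<open>V\<close>, hence in some ball;
  replacing the vector field outside of the ball by its value at the nearest point of the ball makes
  it globally Lipschitz without changing the solution until the trigger. The first hitting time of the
  level is attained by compactness, and uniqueness shows that no other solution hits the level
  earlier, so that it is the infimum in the definition of the trigger. The vector field does not
  depend on time, whence one flow serves all starting times \<open>s\<close>.
\<close>

lemma flow_until_trigger:
  fixes f :: "real^'n \<Rightarrow> real^'m \<Rightarrow> real^'n"
    and g :: "real^'n \<Rightarrow> real^'m \<Rightarrow> real^'l^'n"
    and k :: "real^'l \<Rightarrow> real^'n \<Rightarrow> real^'m"
    and \<theta> \<eta> :: "real^'l" and \<xi> :: "real^'n"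
  defines "F \<equiv> closed_loop f g k \<theta> \<eta>"
  assumes F: "lipschitz_on_balls F" and F0: "F 0 = 0"
    and Vcont: "continuous_on UNIV (V \<eta>)" and Vbdd: "\<And>c. bounded {x. V \<eta> x \<le> c}"
    and start: "\<xi> \<noteq> 0 \<Longrightarrow> V \<eta> \<xi> < Q \<eta> \<xi> + a \<xi>"
    and T: "0 < T"
  shows "\<exists>y h. 0 < h \<and> h \<le> T \<and> y 0 = \<xi> \<and> ode_solution F {0..h} y \<and>
    (\<forall>s. ereal (s + h) = min (ereal (s + T)) (trigger_time f g k V Q a T \<theta> \<eta> s \<xi>))"
proof (cases "\<xi> = 0")
  case True
  then show ?thesis
    using T F0
    by (intro exI[of _ "\<lambda>_. 0"] exI[of _ T])
      (auto simp: ode_solution_def trigger_time_def min_def)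
next
  case False
  define c where "c = Q \<eta> \<xi> + a \<xi>"
  obtain R where R: "0 < R" "{x. V \<eta> x \<le> c} \<subseteq> cball 0 R"
    using bounded_subset_ballD[OF Vbdd[of c], of 0] ball_subset_cball by (meson order_trans)
  obtain L where L: "L > 0" "L-lipschitz_on (cball 0 R) F"
    using F by (rule lipschitz_on_ballsE)
  \<comment> \<open>Composition with the nonexpansive projection onto the ball keeps the Lipschitz constant.\<close>
  define P where "P = closest_point (cball (0 :: real^'n) R)"
  have P: "P x \<in> cball 0 R" "dist (P x) (P z) \<le> dist x z" for x z
    unfolding P_def using R(1)
    by (intro closest_point_in_set closest_point_lipschitz; simp)+
  have P_id: "P x = x" if "x \<in> cball 0 R" for x
    unfolding P_def using that by (rule closest_point_self)
  have "L-lipschitz_on UNIV (\<lambda>x. F (P x))"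
  proof (rule lipschitz_onI)
    fix x z
    have "dist (F (P x)) (F (P z)) \<le> L * dist (P x) (P z)"
      by (intro lipschitz_onD[OF L(2)] P)
    also have "\<dots> \<le> L * dist x z"
      using L(1) by (intro mult_left_mono P) auto
    finally show "dist (F (P x)) (F (P z)) \<le> L * dist x z" .
  qed (use L(1) in simp)
  then obtain y where y: "y 0 = \<xi>" "ode_solution (\<lambda>x. F (P x)) {0..T} y"
    using global_lipschitz_ode_solution_exists[of L "\<lambda>x. F (P x)" T \<xi>] L(1) T by auto
  have ycont: "continuous_on {0..T} y"
    using y(2) by (rule ode_solution_imp_continuous_on)
  define W where "W = (\<lambda>t. V \<eta> (y t))"
  have Wcont: "continuous_on {0..T} W"
    unfolding W_def by (rule continuous_on_compose2[OF Vcont ycont]) simp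
  have W0: "W 0 < c"
    using start[OF False] by (simp add: W_def c_def y(1))
  define hits where "hits = {t \<in> {0..T}. W t = c}"
  have hits: "compact hits"
  proof -
    have "hits = {0..T} \<inter> W -` {c}"
      by (auto simp: hits_def)
    then have "closed hits"
      using continuous_closed_preimage[OF Wcont] by simp
    moreover have "bounded hits"
      by (rule bounded_subset[of "{0..T}"]) (auto simp: hits_def)
    ultimately show ?thesis
      by (simp add: compact_eq_bounded_closed)
  qed
  obtain h where h: "0 < h" "h \<le> T" and before: "\<And>t. t < h \<Longrightarrow> t \<notin> hits"
    and at: "h \<in> hits \<or> h = T"
  proof (cases "hits = {}")
    case True
    then show thesis using that[of T] T by auto
  next
    case nonempty: False
    then obtain h where h: "h \<in> hits" "\<And>t. t \<in> hits \<Longrightarrow> h \<le> t"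
      using compact_attains_inf[OF hits] by auto
    moreover have "0 < h"
      using h(1) W0 by (cases "h = 0") (auto simp: hits_def)
    ultimately show thesis
      using that[of h] by (force simp: hits_def)
  qed
  have below: "W t \<le> c" if t: "t \<in> {0..h}" for t
  proof (rule ccontr)
    assume "\<not> W t \<le> c"
    moreover have "continuous_on {0..t} W"
      using Wcont by (rule continuous_on_subset) (use t h in auto)
    ultimately obtain r where r: "0 \<le> r" "r \<le> t" "W r = c"
      using IVT'[of W 0 c t] W0 t by auto
    then have "r \<noteq> t"
      using \<open>\<not> W t \<le> c\<close> by auto
    then have "r \<in> hits" "r < h"
      using r t h by (auto simp: hits_def)
    then show False
      using before by blast
  qed
  have sol: "ode_solution F {0..h} y"
    unfolding ode_solution_def
  proof
    fix t assume t: "t \<in> {0..h}"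
    have "y t \<in> cball 0 R"
      using below[OF t] R(2) by (auto simp: W_def)
    then have "P (y t) = y t"
      by (rule P_id)
    then show "(y has_vector_derivative F (y t)) (at t within {0..h})"
      using ode_solution_subset[OF y(2), of "{0..h}"] h(2) t
      unfolding ode_solution_def by fastforce
  qed
  have "ereal (s + h) = min (ereal (s + T)) (trigger_time f g k V Q a T \<theta> \<eta> s \<xi>)" for s
  proof -
    define S where "S = {t. s < t \<and> (\<exists>z. ode_solution F {s..t} z \<and> z s = \<xi> \<and> V \<eta> (z t) = c)}"
    have trigger: "trigger_time f g k V Q a T \<theta> \<eta> s \<xi> = Inf (ereal ` S)"
      using False by (simp add: trigger_time_def S_def F_def c_def)
    have "s + h \<le> t" if tS: "t \<in> S" for t
    proof (rule ccontr)
      assume "\<not> s + h \<le> t"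
      then have th: "t - s < h" by simp
      obtain z where t: "s < t" and z: "ode_solution F {s..t} z" "z s = \<xi>" "V \<eta> (z t) = c"
        using tS by (auto simp: S_def)
      have z': "ode_solution F {0..t - s} (\<lambda>r. z (r + s))"
        by (rule ode_solution_shift) (use z(1) in simp)
      have y': "ode_solution F {0..t - s} y"
        using sol by (rule ode_solution_subset) (use th in auto)
      have "y (t - s) = z (t - s + s)"
        by (rule ode_solution_unique[OF F ode_solution_imp_continuous_on[OF y'] _
              ode_solution_imp_continuous_on[OF z']])
          (use t y(1) z(2) y' z' in \<open>auto intro: ode_solution_subset\<close>)
      then have "t - s \<in> hits"
        using z(3) t th h(2) by (simp add: hits_def W_def)
      then show False
        using before th by blast
    qed
    then have le: "ereal (s + h) \<le> Inf (ereal ` S)"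
      by (auto intro!: Inf_greatest)
    show ?thesis
    proof (cases "h \<in> hits")
      case True
      have "ode_solution F {s..s + h} (\<lambda>r. y (r + - s))"
        by (rule ode_solution_shift) (use sol in simp)
      then have "s + h \<in> S"
        using h True y(1) by (auto simp: S_def hits_def W_def intro!: exI[of _ "\<lambda>r. y (r + - s)"])
      then have "Inf (ereal ` S) \<le> ereal (s + h)"
        by (intro Inf_lower) auto
      then show ?thesis
        using le h(2) by (simp add: trigger min_def antisym)
    next
      case False
      then show ?thesis
        using at le by (simp add: trigger min_def)
    qed
  qed
  then show ?thesis
    using h y(1) sol by blast
qed

section \<open>Least-squares identification\<close>

text \<open>
  What remains of the hybrid system when the estimates \<open>E i\<close> are an arbitrary sequence: neither the
  event rule nor the parameter update is imposed. Identification only uses this part, and the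
  construction of solutions needs it before the estimates are chosen.
\<close>

definition sampled_loop ::
  "(real^'n \<Rightarrow> real^'m \<Rightarrow> real^'n) \<Rightarrow> (real^'n \<Rightarrow> real^'m \<Rightarrow> real^'l^'n) \<Rightarrow>
   (real^'l \<Rightarrow> real^'n \<Rightarrow> real^'m) \<Rightarrow> real^'l \<Rightarrow> (real \<Rightarrow> real^'n) \<Rightarrow> (real \<Rightarrow> real^'m) \<Rightarrow>
   (nat \<Rightarrow> real) \<Rightarrow> (nat \<Rightarrow> real^'l) \<Rightarrow> bool" where
  "sampled_loop f g k \<theta> x u \<tau> E \<longleftrightarrow>
     \<tau> 0 = 0 \<and> (\<forall>i. \<tau> i < \<tau> (Suc i)) \<and> (\<forall>i. continuous_on {0..\<tau> i} x) \<and>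
     (\<forall>i. \<forall>t\<in>{\<tau> i..<\<tau> (Suc i)}.
        (x has_vector_derivative f (x t) (u t) + g (x t) (u t) *v \<theta>)
          (at t within {\<tau> i..<\<tau> (Suc i)}) \<and> u t = k (E i) (x t))"

lemma sampled_loopD:
  assumes "sampled_loop f g k \<theta> x u \<tau> E"
  shows "\<tau> 0 = 0" and "\<And>i. \<tau> i < \<tau> (Suc i)" and "\<And>i. continuous_on {0..\<tau> i} x"
    and "\<And>t i. t \<in> {\<tau> i..<\<tau> (Suc i)} \<Longrightarrow> (x has_vector_derivative f (x t) (u t) + g (x t) (u t) *v \<theta>)
          (at t within {\<tau> i..<\<tau> (Suc i)})"
    and "\<And>t i. t \<in> {\<tau> i..<\<tau> (Suc i)} \<Longrightarrow> u t = k (E i) (x t)"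
  using assms unfolding sampled_loop_def by blast+

lemma sampled_loop_times:
  assumes "sampled_loop f g k \<theta> x u \<tau> E"
  shows "strict_mono \<tau>" "0 \<le> \<tau> i"
proof -
  show *: "strict_mono \<tau>"
    using sampled_loopD(2)[OF assms] by (simp add: strict_mono_Suc_iff)
  show "0 \<le> \<tau> i"
    using strict_mono_leD[OF *, of 0 i] sampled_loopD(1)[OF assms] by simp
qed

lemma sampled_loop_interval:
  assumes "sampled_loop f g k \<theta> x u \<tau> E" "0 \<le> t" "t < \<tau> i"
  shows "\<exists>j<i. t \<in> {\<tau> j..<\<tau> (Suc j)}"
  using assms(3)
proof (induction i)
  case 0
  then show ?case using assms(2) sampled_loopD(1)[OF assms(1)] by simp
next
  case (Suc i)
  then show ?case
    by (cases "t < \<tau> i") (auto simp: less_Suc_eq)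
qed

lemma sampled_loop_ode_solution:
  assumes "sampled_loop f g k \<theta> x u \<tau> E"
  shows "ode_solution (closed_loop f g k \<theta> (E i)) {\<tau> i..<\<tau> (Suc i)} x"
  using sampled_loopD(4,5)[OF assms] by (simp add: ode_solution_def closed_loop_def)

text \<open>
  The endpoint of each sampling interval carries the next input value, so the pieces are half-open,
  and single points are added separately.
\<close>

lemma sampled_loop_set_integrable:
  fixes h :: "real^'n \<Rightarrow> real^'m \<Rightarrow> 'b::euclidean_space"
  assumes S: "sampled_loop f g k \<theta> x u \<tau> E"
    and h: "\<And>\<eta>. continuous_on UNIV (\<lambda>x. h x (k \<eta> x))"
  shows "set_integrable lborel {0..\<tau> i} (\<lambda>s. h (x s) (u s))"
proof (induction i)
  case 0
  have "set_integrable lborel {0..0} (\<lambda>s. h (x s) (u s))"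
    by (intro borel_integrable_atLeastAtMost') simp
  then show ?case
    by (simp add: sampled_loopD(1)[OF S])
next
  case (Suc i)
  have nonneg: "0 \<le> \<tau> i" and less: "\<tau> i < \<tau> (Suc i)"
    using sampled_loop_times[OF S] sampled_loopD(2)[OF S] by auto
  have xcont: "continuous_on {\<tau> i..\<tau> (Suc i)} x"
    using sampled_loopD(3)[OF S, of "Suc i"] by (rule continuous_on_subset) (use nonneg in auto)
  have "set_integrable lborel {\<tau> i..\<tau> (Suc i)} (\<lambda>s. h (x s) (k (E i) (x s)))"
    by (intro borel_integrable_atLeastAtMost' continuous_on_compose2[OF h xcont]) simp
  then have "set_integrable lborel {\<tau> i..<\<tau> (Suc i)} (\<lambda>s. h (x s) (k (E i) (x s)))"
    by (rule set_integrable_subset) auto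
  then have "set_integrable lborel {\<tau> i..<\<tau> (Suc i)} (\<lambda>s. h (x s) (u s))"
    by (rule iffD1[OF set_integrable_cong, rotated -1]) (use sampled_loopD(5)[OF S] in auto)
  moreover have "set_integrable lborel {\<tau> (Suc i)..\<tau> (Suc i)} (\<lambda>s. h (x s) (u s))"
    by (intro borel_integrable_atLeastAtMost') simp
  ultimately have "set_integrable lborel ({0..\<tau> i} \<union> ({\<tau> i..<\<tau> (Suc i)} \<union> {\<tau> (Suc i)..\<tau> (Suc i)}))
      (\<lambda>s. h (x s) (u s))"
    using Suc by (intro set_integrable_Un) auto
  moreover have "{0..\<tau> i} \<union> ({\<tau> i..<\<tau> (Suc i)} \<union> {\<tau> (Suc i)..\<tau> (Suc i)}) = {0..\<tau> (Suc i)}"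
    using nonneg less by auto
  ultimately show ?case
    by simp
qed

lemma sampled_loop_set_integrable_subinterval:
  fixes h :: "real^'n \<Rightarrow> real^'m \<Rightarrow> 'b::euclidean_space"
  assumes S: "sampled_loop f g k \<theta> x u \<tau> E"
    and h: "\<And>\<eta>. continuous_on UNIV (\<lambda>x. h x (k \<eta> x))"
    and "0 \<le> \<sigma>" "t \<le> \<tau> i"
  shows "set_integrable lborel {\<sigma>..t} (\<lambda>s. h (x s) (u s))"
  by (rule set_integrable_subset[OF sampled_loop_set_integrable[where h = h, OF S h, of i]])
    (use assms(3,4) in auto)

lemma sampled_loop_LBINT:
  fixes h :: "real^'n \<Rightarrow> real^'m \<Rightarrow> 'b::euclidean_space"
  assumes S: "sampled_loop f g k \<theta> x u \<tau> E"
    and h: "\<And>\<eta>. continuous_on UNIV (\<lambda>x. h x (k \<eta> x))"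
    and t: "t \<in> {0..\<tau> i}" and \<sigma>: "\<sigma> \<in> {0..\<tau> i}"
  shows "(LBINT s=ereal \<sigma>..ereal t. h (x s) (u s)) =
    integral {0..t} (\<lambda>s. h (x s) (u s)) - integral {0..\<sigma>} (\<lambda>s. h (x s) (u s))"
proof -
  have *: "(LBINT s=ereal \<sigma>..ereal t. h (x s) (u s)) =
    integral {0..t} (\<lambda>s. h (x s) (u s)) - integral {0..\<sigma>} (\<lambda>s. h (x s) (u s))"
    if le: "0 \<le> \<sigma>" "\<sigma> \<le> t" "t \<le> \<tau> i" for t \<sigma>
  proof -
    have int: "set_integrable lborel {r..t} (\<lambda>s. h (x s) (u s))" if "0 \<le> r" for r
      using sampled_loop_set_integrable_subinterval[where h = h, OF S h that le(3)] .
    have "(\<lambda>s. h (x s) (u s)) integrable_on {0..t}"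
      using set_borel_integral_eq_integral(1)[OF int[of 0]] by simp
    then have "integral {0..\<sigma>} (\<lambda>s. h (x s) (u s)) + integral {\<sigma>..t} (\<lambda>s. h (x s) (u s)) =
        integral {0..t} (\<lambda>s. h (x s) (u s))"
      using le by (intro Henstock_Kurzweil_Integration.integral_combine) auto
    then show ?thesis
      using interval_integral_eq_integral[OF le(2) int[OF le(1)]] by (simp add: algebra_simps)
  qed
  show ?thesis
  proof (cases "\<sigma> \<le> t")
    case True
    then show ?thesis using t \<sigma> by (intro *) auto
  next
    case False
    then show ?thesis
      using *[of t \<sigma>] t \<sigma>
      by (subst interval_integral_endpoints_reverse) auto
  qed
qed

text \<open>
  The fundamental theorem of calculus with the event times as finite exceptional set. This identity
  makes \<open>p = q \<theta>\<close> hold for the regressors \<open>p\<close> and \<open>q\<close>.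
\<close>

lemma sampled_loop_displacement:
  fixes f :: "real^'n \<Rightarrow> real^'m \<Rightarrow> real^'n"
    and g :: "real^'n \<Rightarrow> real^'m \<Rightarrow> real^'l^'n"
  assumes S: "sampled_loop f g k \<theta> x u \<tau> E"
    and f: "\<And>\<eta>. continuous_on UNIV (\<lambda>x. f x (k \<eta> x))"
    and g: "\<And>\<eta>. continuous_on UNIV (\<lambda>x. g x (k \<eta> x))"
    and t: "t \<in> {0..\<tau> i}"
  shows "x t - x 0 = integral {0..t} (\<lambda>s. f (x s) (u s)) + integral {0..t} (\<lambda>s. g (x s) (u s)) *v \<theta>"
proof -
  let ?f = "\<lambda>s. f (x s) (u s)" and ?g = "\<lambda>s. g (x s) (u s)"
  have int: "?f integrable_on {0..t}" "?g integrable_on {0..t}"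
    using sampled_loop_set_integrable_subinterval[where h = f, OF S f, of 0 t i]
      sampled_loop_set_integrable_subinterval[where h = g, OF S g, of 0 t i] t
    by (auto dest: set_borel_integral_eq_integral(1))
  have "((\<lambda>s. ?f s + ?g s *v \<theta>) has_integral (x t - x 0)) {0..t}"
  proof (rule fundamental_theorem_of_calculus_interior_strong[of "\<tau> ` {..i}"])
    show "continuous_on {0..t} x"
      using sampled_loopD(3)[OF S, of i] by (rule continuous_on_subset) (use t in auto)
    fix s assume s: "s \<in> {0<..<t} - \<tau> ` {..i}"
    then obtain j where j: "j < i" "s \<in> {\<tau> j..<\<tau> (Suc j)}"
      using sampled_loop_interval[OF S, of s i] t by auto
    have "s \<noteq> \<tau> j"
      using s j(1) by auto
    then show "(x has_vector_derivative ?f s + ?g s *v \<theta>) (at s)"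
      using has_vector_derivative_halfopen_imp_at[OF sampled_loopD(4)[OF S j(2)]] j(2) by auto
  qed (use t in auto)
  then have "x t - x 0 = integral {0..t} (\<lambda>s. ?f s + ?g s *v \<theta>)"
    by (simp add: integral_unique)
  also have "\<dots> = integral {0..t} ?f + integral {0..t} ((\<lambda>A. A *v \<theta>) \<circ> ?g)"
    using integrable_linear[OF int(2) bounded_linear_matrix_vector_mult_left[of \<theta>]] int(1)
    by (simp add: integral_add o_def)
  also have "integral {0..t} ((\<lambda>A. A *v \<theta>) \<circ> ?g) = integral {0..t} ?g *v \<theta>"
    by (rule integral_linear[OF int(2) bounded_linear_matrix_vector_mult_left])
  finally show ?thesis .
qed

lemma continuous_on_section:
  assumes K: "continuous_on (A \<times> B) (\<lambda>(t, \<sigma>). K t \<sigma>)" and t: "t \<in> A"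
  shows "continuous_on B (K t)"
proof -
  have "continuous_on B (\<lambda>\<sigma>. (t, \<sigma>))"
    by (intro continuous_intros)
  moreover have "(\<lambda>\<sigma>. (t, \<sigma>)) ` B \<subseteq> A \<times> B"
    using t by auto
  ultimately show ?thesis
    using continuous_on_compose2[OF K, of B "\<lambda>\<sigma>. (t, \<sigma>)"] by simp
qed

lemma iterated_integral_bounded_linear:
  fixes K :: "real \<Rightarrow> real \<Rightarrow> 'a::euclidean_space"
  assumes K: "continuous_on ({a..b} \<times> {a..b}) (\<lambda>(t, \<sigma>). K t \<sigma>)" and A: "bounded_linear A"
  shows "A (integral {a..b} (\<lambda>t. integral {a..b} (K t))) =
    integral {a..b} (\<lambda>t. integral {a..b} (\<lambda>\<sigma>. A (K t \<sigma>)))"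
proof -
  have inner: "K t integrable_on {a..b}" if "t \<in> {a..b}" for t
    by (rule integrable_continuous_real[OF continuous_on_section[OF K that]])
  have "(\<lambda>t. integral {a..b} (K t)) integrable_on {a..b}"
    using integral_continuous_on_param[of "{a..b}" a b K] K
    by (intro integrable_continuous_real) simp
  then have "A (integral {a..b} (\<lambda>t. integral {a..b} (K t))) =
      integral {a..b} (\<lambda>t. A (integral {a..b} (K t)))"
    using integral_linear[OF _ A, of "\<lambda>t. integral {a..b} (K t)"] by (simp add: o_def)
  also have "\<dots> = integral {a..b} (\<lambda>t. integral {a..b} (\<lambda>\<sigma>. A (K t \<sigma>)))"
    by (rule integral_cong) (use integral_linear[OF inner A] in \<open>simp add: o_def\<close>)
  finally show ?thesis .
qed

lemma iterated_LBINT_eq_integral: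
  fixes K :: "real \<Rightarrow> real \<Rightarrow> 'a::euclidean_space"
  assumes K: "continuous_on ({a..b} \<times> {a..b}) (\<lambda>(t, \<sigma>). K t \<sigma>)" and ab: "a \<le> b"
  shows "(LBINT t=ereal a..ereal b. (LBINT \<sigma>=ereal a..ereal b. K t \<sigma>)) =
    integral {a..b} (\<lambda>t. integral {a..b} (K t))"
proof -
  have inner: "(LBINT \<sigma>=ereal a..ereal b. K t \<sigma>) = integral {a..b} (K t)" if "t \<in> {a..b}" for t
    by (rule interval_integral_eq_integral[OF ab
          borel_integrable_atLeastAtMost'[OF continuous_on_section[OF K that]]])
  have "(LBINT t=ereal a..ereal b. (LBINT \<sigma>=ereal a..ereal b. K t \<sigma>)) =
      (LBINT t=ereal a..ereal b. integral {a..b} (K t))"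
    using ab by (intro interval_integral_cong) (auto simp: inner einterval_iff)
  also have "\<dots> = integral {a..b} (\<lambda>t. integral {a..b} (K t))"
    using integral_continuous_on_param[of "{a..b}" a b K] K ab
    by (intro interval_integral_eq_integral borel_integrable_atLeastAtMost') simp_all
  finally show ?thesis .
qed

lemma continuous_on_gram:
  fixes A :: "'a::topological_space \<Rightarrow> real^'l^'n"
  assumes "continuous_on S A"
  shows "continuous_on S (\<lambda>s. transpose (A s) ** A s)"
  unfolding matrix_matrix_mult_def transpose_def
  by (intro continuous_on_vec_lambda continuous_on_sum continuous_on_mult)
    (simp_all add: continuous_on_component assms)

lemma inner_gram: "d \<bullet> ((transpose A ** A) *v d) = (norm (A *v d))\<^sup>2"
  for A :: "real^'l^'n"
  by (simp add: dot_lmul_matrix[symmetric] matrix_vector_mul_assoc[symmetric] dot_square_norm[symmetric]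
      vector_transpose_matrix inner_commute)

text \<open>
  \<open>d \<bullet> G d\<close> is the double integral of \<open>|(\<Gamma> t - \<Gamma> \<sigma>) d|\<^sup>2\<close>, and a continuous nonnegative function with
  zero integral vanishes.
\<close>

lemma iterated_gram_kernel:
  fixes \<Gamma> :: "real \<Rightarrow> real^'l^'n"
  assumes \<Gamma>: "continuous_on {a..b} \<Gamma>" and ab: "a < b"
    and zero: "integral {a..b} (\<lambda>t. integral {a..b} (\<lambda>\<sigma>. transpose (\<Gamma> t - \<Gamma> \<sigma>) ** (\<Gamma> t - \<Gamma> \<sigma>))) *v d = 0"
    and t: "t \<in> {a..b}" and \<sigma>: "\<sigma> \<in> {a..b}"
  shows "(\<Gamma> t - \<Gamma> \<sigma>) *v d = 0"
proof -
  define K where "K = (\<lambda>t \<sigma>. transpose (\<Gamma> t - \<Gamma> \<sigma>) ** (\<Gamma> t - \<Gamma> \<sigma>))"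
  have diff: "continuous_on ({a..b} \<times> {a..b}) (\<lambda>z. \<Gamma> (fst z) - \<Gamma> (snd z))"
    by (intro continuous_intros continuous_on_compose2[OF \<Gamma>]) auto
  have K: "continuous_on ({a..b} \<times> {a..b}) (\<lambda>(t, \<sigma>). K t \<sigma>)"
    using continuous_on_gram[OF diff] by (simp add: K_def case_prod_beta)
  define \<phi> where "\<phi> = (\<lambda>t \<sigma>. (norm ((\<Gamma> t - \<Gamma> \<sigma>) *v d))\<^sup>2)"
  have \<phi>: "continuous_on ({a..b} \<times> {a..b}) (\<lambda>(t, \<sigma>). \<phi> t \<sigma>)"
    unfolding \<phi>_def case_prod_beta
    by (intro continuous_intros bounded_linear.continuous_on[OF bounded_linear_matrix_vector_mult_left] diff)
  have \<phi>_inner: "continuous_on {a..b} (\<phi> t)" if "t \<in> {a..b}" for t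
    by (rule continuous_on_section[OF \<phi> that])
  have "bounded_linear (\<lambda>A::real^'l^'l. d \<bullet> (A *v d))"
    by (intro bounded_linear_compose[OF bounded_linear_inner_right]
        bounded_linear_matrix_vector_mult_left)
  then have "integral {a..b} (\<lambda>t. integral {a..b} (\<phi> t)) =
      d \<bullet> (integral {a..b} (\<lambda>t. integral {a..b} (K t)) *v d)"
    using iterated_integral_bounded_linear[OF K, of "\<lambda>A. d \<bullet> (A *v d)"]
    by (simp add: K_def \<phi>_def inner_gram)
  then have "integral {a..b} (\<lambda>t. integral {a..b} (\<phi> t)) = 0"
    using zero by (simp add: K_def)
  moreover have "continuous_on {a..b} (\<lambda>t. integral {a..b} (\<phi> t))"
    using integral_continuous_on_param[of "{a..b}" a b \<phi>] \<phi> by simp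
  moreover have "0 \<le> integral {a..b} (\<phi> t)" if "t \<in> {a..b}" for t
    using that by (intro integral_nonneg integrable_continuous_real \<phi>_inner) (auto simp: \<phi>_def)
  ultimately have "integral {a..b} (\<phi> t) = 0"
    using integral_eq_0_iff[of a b "\<lambda>t. integral {a..b} (\<phi> t)"] ab t by blast
  then have "\<phi> t \<sigma> = 0"
    using integral_eq_0_iff[OF \<phi>_inner[OF t] ab] \<sigma> by (auto simp: \<phi>_def)
  then show ?thesis
    by (simp add: \<phi>_def)
qed

lemma integral_eq_0_imp_eq_0:
  fixes \<phi> :: "real \<Rightarrow> 'a::banach"
  assumes cont: "continuous_on {a..b} \<phi>" and zero: "\<And>t. t \<in> {a..<b} \<Longrightarrow> integral {a..t} \<phi> = 0"
    and ab: "a < b" and s: "s \<in> {a..b}"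
  shows "\<phi> s = 0"
proof -
  have "\<phi> r = 0" if r: "r \<in> {a<..<b}" for r
  proof -
    have "((\<lambda>t. integral {a..t} \<phi>) has_vector_derivative \<phi> r) (at r within {a<..<b})"
      using integral_has_vector_derivative[OF cont, of r] r
      by (auto intro: has_vector_derivative_within_subset)
    then have "((\<lambda>t. integral {a..t} \<phi>) has_vector_derivative \<phi> r) (at r)"
      using r by (simp add: at_within_open[of r "{a<..<b}"])
    then have "((\<lambda>t. 0) has_vector_derivative \<phi> r) (at r)"
      by (rule has_vector_derivative_transform_within_open[where S = "{a<..<b}"])
        (use r zero in auto)
    then show ?thesis
      using vector_derivative_unique_at has_vector_derivative_const by blast
  qed
  moreover have closure: "closure {a<..<b} = {a..b}"
    using ab by (rule closure_greaterThanLessThan)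
  ultimately show ?thesis
    using cont s by (intro continuous_constant_on_closure[of "{a<..<b}" \<phi> 0 s]) (simp_all add: closure)
qed

text \<open>
  With \<open>\<Gamma>\<close> the running integral of \<open>g\<close>, the regressor is the difference \<open>\<Gamma> t - \<Gamma> \<sigma>\<close> whatever the
  order of \<open>t\<close> and \<open>\<sigma>\<close>; being continuous, it turns the oriented integrals in the definition of the
  Gramian into integrals of continuous functions over a square.
\<close>

lemma gramian_eq_integral:
  fixes g :: "real^'n \<Rightarrow> real^'m \<Rightarrow> real^'l^'n"
  assumes S: "sampled_loop f g k \<theta> x u \<tau> E"
    and g: "\<And>\<eta>. continuous_on UNIV (\<lambda>x. g x (k \<eta> x))"
    and \<mu>: "0 \<le> \<mu>" "\<mu> < \<nu>" "\<nu> \<le> \<tau> i"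
    and \<Gamma>_def: "\<Gamma> = (\<lambda>t. integral {0..t} (\<lambda>s. g (x s) (u s)))"
  shows "continuous_on {\<mu>..\<nu>} \<Gamma>"
    and "continuous_on ({\<mu>..\<nu>} \<times> {\<mu>..\<nu>}) (\<lambda>(t, \<sigma>). transpose (\<Gamma> t - \<Gamma> \<sigma>) ** (\<Gamma> t - \<Gamma> \<sigma>))"
    and "\<And>t \<sigma>. t \<in> {\<mu>..\<nu>} \<Longrightarrow> \<sigma> \<in> {\<mu>..\<nu>} \<Longrightarrow> q_reg g x u t \<sigma> = \<Gamma> t - \<Gamma> \<sigma>"
    and "G_mat g x u \<nu> \<mu> =
      integral {\<mu>..\<nu>} (\<lambda>t. integral {\<mu>..\<nu>} (\<lambda>\<sigma>. transpose (\<Gamma> t - \<Gamma> \<sigma>) ** (\<Gamma> t - \<Gamma> \<sigma>)))"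
proof -
  have "(\<lambda>s. g (x s) (u s)) integrable_on {0..\<tau> i}"
    using sampled_loop_set_integrable[where h = g, OF S g] by (rule set_borel_integral_eq_integral(1))
  then have "continuous_on {0..\<tau> i} \<Gamma>"
    unfolding \<Gamma>_def by (rule indefinite_integral_continuous_1)
  then show \<Gamma>: "continuous_on {\<mu>..\<nu>} \<Gamma>"
    by (rule continuous_on_subset) (use \<mu> in auto)
  have diff: "continuous_on ({\<mu>..\<nu>} \<times> {\<mu>..\<nu>}) (\<lambda>z. \<Gamma> (fst z) - \<Gamma> (snd z))"
    by (intro continuous_intros continuous_on_compose2[OF \<Gamma>]) auto
  show K: "continuous_on ({\<mu>..\<nu>} \<times> {\<mu>..\<nu>}) (\<lambda>(t, \<sigma>). transpose (\<Gamma> t - \<Gamma> \<sigma>) ** (\<Gamma> t - \<Gamma> \<sigma>))"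
    using continuous_on_gram[OF diff] by (simp add: case_prod_beta)
  show q: "q_reg g x u t \<sigma> = \<Gamma> t - \<Gamma> \<sigma>" if "t \<in> {\<mu>..\<nu>}" "\<sigma> \<in> {\<mu>..\<nu>}" for t \<sigma>
    unfolding q_reg_def \<Gamma>_def by (rule sampled_loop_LBINT[where h = g, OF S g, of _ i]) (use that \<mu> in auto)
  show "G_mat g x u \<nu> \<mu> =
      integral {\<mu>..\<nu>} (\<lambda>t. integral {\<mu>..\<nu>} (\<lambda>\<sigma>. transpose (\<Gamma> t - \<Gamma> \<sigma>) ** (\<Gamma> t - \<Gamma> \<sigma>)))"
    unfolding G_mat_def
    using \<mu> by (subst iterated_LBINT_eq_integral[OF K, symmetric])
      (auto intro!: interval_integral_cong simp: einterval_iff q)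
qed

text \<open>
  Since \<open>p = q \<theta>\<close>, also \<open>q\<^sup>T p = (q\<^sup>T q) \<theta>\<close> under the integral sign.
\<close>

lemma true_parameter_solves_normal_equation:
  fixes f :: "real^'n \<Rightarrow> real^'m \<Rightarrow> real^'n"
    and g :: "real^'n \<Rightarrow> real^'m \<Rightarrow> real^'l^'n"
  assumes S: "sampled_loop f g k \<theta> x u \<tau> E"
    and f: "\<And>\<eta>. continuous_on UNIV (\<lambda>x. f x (k \<eta> x))"
    and g: "\<And>\<eta>. continuous_on UNIV (\<lambda>x. g x (k \<eta> x))"
    and \<mu>: "0 \<le> \<mu>" "\<mu> < \<nu>" "\<nu> \<le> \<tau> i"
  shows "Z_vec f g x u \<nu> \<mu> = G_mat g x u \<nu> \<mu> *v \<theta>"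
proof -
  define \<Gamma> where "\<Gamma> = (\<lambda>t. integral {0..t} (\<lambda>s. g (x s) (u s)))"
  note gram = gramian_eq_integral[OF S g \<mu> \<Gamma>_def]
  define K where "K = (\<lambda>t \<sigma>. transpose (\<Gamma> t - \<Gamma> \<sigma>) ** (\<Gamma> t - \<Gamma> \<sigma>))"
  have K: "continuous_on ({\<mu>..\<nu>} \<times> {\<mu>..\<nu>}) (\<lambda>(t, \<sigma>). K t \<sigma>)"
    using gram(2) by (simp add: K_def)
  have K\<theta>: "continuous_on ({\<mu>..\<nu>} \<times> {\<mu>..\<nu>}) (\<lambda>(t, \<sigma>). K t \<sigma> *v \<theta>)"
    using bounded_linear.continuous_on[OF bounded_linear_matrix_vector_mult_left K]
    by (simp add: case_prod_beta)
  have p: "p_reg f x u t \<sigma> = (\<Gamma> t - \<Gamma> \<sigma>) *v \<theta>" if "t \<in> {\<mu>..\<nu>}" "\<sigma> \<in> {\<mu>..\<nu>}" for t \<sigma>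
  proof -
    have ts: "t \<in> {0..\<tau> i}" "\<sigma> \<in> {0..\<tau> i}"
      using that \<mu> by auto
    show ?thesis
      using sampled_loop_displacement[OF S f g ts(1)] sampled_loop_displacement[OF S f g ts(2)]
      unfolding p_reg_def sampled_loop_LBINT[where h = f, OF S f ts] \<Gamma>_def
      by (simp add: algebra_simps matrix_vector_mult_diff_rdistrib)
  qed
  have "Z_vec f g x u \<nu> \<mu> =
      (LBINT t=ereal \<mu>..ereal \<nu>. (LBINT \<sigma>=ereal \<mu>..ereal \<nu>. K t \<sigma> *v \<theta>))"
    unfolding Z_vec_def using \<mu>
    by (intro interval_integral_cong)
      (auto simp: einterval_iff gram(3) p K_def matrix_vector_mul_assoc)
  also have "\<dots> = integral {\<mu>..\<nu>} (\<lambda>t. integral {\<mu>..\<nu>} (K t)) *v \<theta>"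
    using \<mu> iterated_LBINT_eq_integral[OF K\<theta>]
      iterated_integral_bounded_linear[OF K bounded_linear_matrix_vector_mult_left[of \<theta>]] by simp
  finally show ?thesis
    by (simp add: gram(4) K_def)
qed

text \<open>
  An error left over by least squares cannot be seen on the window: its image under the regressor
  vanishes, and differentiating the running integral inside a sampling interval gives the claim there,
  up to the endpoints by continuity. At the right endpoint the input of the interval that ends there
  is meant, as in the observability hypothesis (iii).
\<close>

lemma gramian_kernel:
  fixes g :: "real^'n \<Rightarrow> real^'m \<Rightarrow> real^'l^'n"
  assumes S: "sampled_loop f g k \<theta> x u \<tau> E"
    and g: "\<And>\<eta>. continuous_on UNIV (\<lambda>x. g x (k \<eta> x))"
    and \<mu>: "0 \<le> \<mu>" "\<mu> \<le> \<tau> j" "j \<le> i"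
    and zero: "G_mat g x u (\<tau> (Suc i)) \<mu> *v d = 0"
    and s: "s \<in> {\<tau> j..\<tau> (Suc j)}"
  shows "g (x s) (k (E j) (x s)) *v d = 0"
proof -
  define \<Gamma> where "\<Gamma> = (\<lambda>t. integral {0..t} (\<lambda>s. g (x s) (u s)))"
  have times: "\<tau> j < \<tau> (Suc j)" "\<tau> (Suc j) \<le> \<tau> (Suc i)" "0 \<le> \<tau> j"
    using sampled_loop_times[OF S] \<mu>(3) by (auto simp: strict_mono_less strict_mono_less_eq)
  then have \<mu>': "\<mu> < \<tau> (Suc i)"
    using \<mu> by linarith
  note gram = gramian_eq_integral[OF S g \<mu>(1) \<mu>' order_refl \<Gamma>_def]
  have xcont: "continuous_on {\<tau> j..\<tau> (Suc j)} x"
    using sampled_loopD(3)[OF S, of "Suc j"] by (rule continuous_on_subset) (use times in auto)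
  define w where "w = (\<lambda>s. g (x s) (k (E j) (x s)))"
  have wcont: "continuous_on {\<tau> j..\<tau> (Suc j)} w"
    unfolding w_def by (rule continuous_on_compose2[OF g xcont]) simp
  have wdcont: "continuous_on {\<tau> j..\<tau> (Suc j)} (\<lambda>s. w s *v d)"
    using bounded_linear.continuous_on[OF bounded_linear_matrix_vector_mult_left wcont] .
  have "integral {\<tau> j..t} (\<lambda>s. w s *v d) = 0" if t: "t \<in> {\<tau> j..<\<tau> (Suc j)}" for t
  proof -
    have "w integrable_on {\<tau> j..t}"
      by (rule integrable_continuous_real, rule continuous_on_subset[OF wcont]) (use t in auto)
    then have "integral {\<tau> j..t} (\<lambda>s. w s *v d) = integral {\<tau> j..t} w *v d"
      using integral_linear[OF _ bounded_linear_matrix_vector_mult_left[of d]] by (simp add: o_def)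
    also have "integral {\<tau> j..t} w = integral {\<tau> j..t} (\<lambda>s. g (x s) (u s))"
      using sampled_loopD(5)[OF S, where i = j] t by (intro integral_cong) (auto simp: w_def)
    also have "\<dots> = (LBINT s=ereal (\<tau> j)..ereal t. g (x s) (u s))"
      using interval_integral_eq_integral[OF _ sampled_loop_set_integrable_subinterval[where h = g, OF S g, of "\<tau> j" t "Suc j"]]
        t times by auto
    also have "\<dots> = \<Gamma> t - \<Gamma> (\<tau> j)"
      using gram(3)[of t "\<tau> j"] t times \<mu> by (auto simp: q_reg_def)
    also have "(\<Gamma> t - \<Gamma> (\<tau> j)) *v d = 0"
      by (rule iterated_gram_kernel[OF gram(1) \<mu>' zero[unfolded gram(4)]]) (use t times \<mu> in auto)
    finally show ?thesis .
  qed
  then have "w s *v d = 0"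
    using integral_eq_0_imp_eq_0[OF wdcont _ times(1) s] by blast
  then show ?thesis
    by (simp add: w_def)
qed

section \<open>Existence of hybrid solutions\<close>

lemma hybrid_solution_iff:
  "hybrid_solution f g k V Q a T N' \<theta> x \<eta> u \<tau> \<longleftrightarrow>
     sampled_loop f g k \<theta> x u \<tau> (\<lambda>i. \<eta> (\<tau> i)) \<and>
     (\<forall>i. \<forall>t\<in>{\<tau> i..<\<tau> (Suc i)}. \<eta> t = \<eta> (\<tau> i)) \<and>
     (\<forall>i. ereal (\<tau> (Suc i)) =
        min (ereal (\<tau> i + T)) (trigger_time f g k V Q a T \<theta> (\<eta> (\<tau> i)) (\<tau> i) (x (\<tau> i)))) \<and>
     (\<forall>i. is_arg_min (\<lambda>\<zeta>. (norm (\<zeta> - \<eta> (\<tau> i)))\<^sup>2)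
        (\<lambda>\<zeta>. Z_vec f g x u (\<tau> (Suc i)) (window_start T N' \<tau> i) =
             G_mat g x u (\<tau> (Suc i)) (window_start T N' \<tau> i) *v \<zeta>)
        (\<eta> (\<tau> (Suc i))))"
  unfolding hybrid_solution_def sampled_loop_def by blast

lemma least_change_solution_exists:
  fixes A :: "real^'l^'n"
  assumes "b = A *v \<theta>"
  shows "\<exists>r. is_arg_min (\<lambda>\<zeta>. (norm (\<zeta> - e))\<^sup>2) (\<lambda>\<zeta>. b = A *v \<zeta>) r"
proof -
  have closed: "closed {\<zeta>. b = A *v \<zeta>}"
    by (intro closed_Collect_eq continuous_intros matrix_vector_mult_linear_continuous_on)
  have ne: "{\<zeta>. b = A *v \<zeta>} \<noteq> {}"
    using assms by blast
  obtain r where "r \<in> {\<zeta>. b = A *v \<zeta>}" "\<And>\<zeta>. \<zeta> \<in> {\<zeta>. b = A *v \<zeta>} \<Longrightarrow> dist e r \<le> dist e \<zeta>"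
    using distance_attains_inf[OF closed ne, of e] by metis
  then have "is_arg_min (\<lambda>\<zeta>. (norm (\<zeta> - e))\<^sup>2) (\<lambda>\<zeta>. b = A *v \<zeta>) r"
    by (auto simp: is_arg_min_linorder dist_norm norm_minus_commute intro: power_mono)
  then show ?thesis ..
qed

text \<open>
  The update is the orthogonal projection onto an affine subspace that contains the true parameter, and
  projections onto convex sets do not increase the distance to points of the set.
\<close>

lemma least_change_solution_error:
  fixes A :: "real^'l^'n"
  assumes r: "is_arg_min (\<lambda>\<zeta>. (norm (\<zeta> - e))\<^sup>2) (\<lambda>\<zeta>. b = A *v \<zeta>) r" and \<theta>: "b = A *v \<theta>"
  shows "A *v (r - \<theta>) = 0" and "norm (r - \<theta>) \<le> norm (e - \<theta>)"
proof -
  have Ar: "b = A *v r" and min: "\<And>\<zeta>. b = A *v \<zeta> \<Longrightarrow> norm (r - e) \<le> norm (\<zeta> - e)"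
    using r by (auto simp: is_arg_min_linorder power_mono_iff)
  show "A *v (r - \<theta>) = 0"
    using Ar \<theta> by (simp add: matrix_vector_mult_diff_distrib)
  have "convex {\<zeta>. b = A *v \<zeta>}"
  proof (rule convexI)
    fix x y :: "real^'l" and s t :: real
    assume "x \<in> {\<zeta>. b = A *v \<zeta>}" "y \<in> {\<zeta>. b = A *v \<zeta>}" "s + t = 1"
    then show "s *\<^sub>R x + t *\<^sub>R y \<in> {\<zeta>. b = A *v \<zeta>}"
      by (simp add: matrix_vector_right_distrib matrix_vector_mult_scaleR
          flip: scaleR_add_left)
  qed
  moreover have "closed {\<zeta>. b = A *v \<zeta>}"
    by (intro closed_Collect_eq continuous_intros matrix_vector_mult_linear_continuous_on)
  ultimately have obtuse: "(e - r) \<bullet> (\<theta> - r) \<le> 0"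
    using Ar \<theta> min by (intro any_closest_point_dot[of "{\<zeta>. b = A *v \<zeta>}"])
      (auto simp: dist_norm norm_minus_commute)
  have "(norm (e - \<theta>))\<^sup>2 = (norm (e - r))\<^sup>2 + (norm (r - \<theta>))\<^sup>2 - 2 * ((e - r) \<bullet> (\<theta> - r))"
    by (simp add: power2_norm_eq_inner algebra_simps inner_commute)
  then have "(norm (r - \<theta>))\<^sup>2 \<le> (norm (e - \<theta>))\<^sup>2"
    using obtuse zero_le_power2[of "norm (e - r)"] by linarith
  then show "norm (r - \<theta>) \<le> norm (e - \<theta>)"
    by (rule power2_le_imp_le) simp
qed

text \<open>
  The window reaches back at least \<open>T\<close>, so it always contains the last sampling interval and the
  minimum is taken over a nonempty set.
\<close>

lemma window_start_eq:
  assumes step: "\<tau> (Suc i) \<le> \<tau> i + T" and T: "0 < T" and N': "0 < N'"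
  obtains j where "j \<le> i" "window_start T N' \<tau> i = \<tau> j"
proof -
  let ?W = "{\<tau> j | j. j \<le> i \<and> \<tau> j \<ge> \<tau> (Suc i) - real N' * T}"
  have "1 * T \<le> real N' * T"
    using N' T by (intro mult_right_mono) auto
  then have "\<tau> i \<in> ?W"
    using step by auto
  moreover have "finite ?W"
    by simp
  ultimately have "Min ?W \<in> ?W"
    by (intro Min_in) auto
  then show thesis
    using that by (auto simp: window_start_def)
qed

lemma window_start_le:
  assumes "j \<le> i" "\<tau> (Suc i) - real N' * T \<le> \<tau> j"
  shows "window_start T N' \<tau> i \<le> \<tau> j"
  unfolding window_start_def using assms by (intro Min_le) auto

lemma LBINT_signal_cong:
  fixes h :: "'a \<Rightarrow> 'b \<Rightarrow> 'c::{banach, second_countable_topology}"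
  assumes "\<And>s. s \<in> {\<mu>..<\<nu>} \<Longrightarrow> x s = x' s \<and> u s = u' s"
    and "t \<in> {\<mu>..<\<nu>}" "\<sigma> \<in> {\<mu>..<\<nu>}"
  shows "(LBINT s=ereal \<sigma>..ereal t. h (x s) (u s)) = (LBINT s=ereal \<sigma>..ereal t. h (x' s) (u' s))"
proof (rule interval_integral_cong)
  fix s assume "s \<in> einterval (min (ereal \<sigma>) (ereal t)) (max (ereal \<sigma>) (ereal t))"
  then have "s \<in> {\<mu>..<\<nu>}"
    using assms(2,3) by (auto simp: einterval_iff min_def max_def split: if_splits)
  then show "h (x s) (u s) = h (x' s) (u' s)"
    using assms(1) by simp
qed

lemma Z_vec_G_mat_cong:
  fixes f :: "real^'n \<Rightarrow> real^'m \<Rightarrow> real^'n"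
    and g :: "real^'n \<Rightarrow> real^'m \<Rightarrow> real^'l^'n"
  assumes eq: "\<And>s. s \<in> {\<mu>..<\<nu>} \<Longrightarrow> x s = x' s \<and> u s = u' s" and le: "\<mu> \<le> \<nu>"
  shows "Z_vec f g x u \<nu> \<mu> = Z_vec f g x' u' \<nu> \<mu>" "G_mat g x u \<nu> \<mu> = G_mat g x' u' \<nu> \<mu>"
proof -
  have q: "q_reg g x u t \<sigma> = q_reg g x' u' t \<sigma>" and p: "p_reg f x u t \<sigma> = p_reg f x' u' t \<sigma>"
    if "t \<in> {\<mu>..<\<nu>}" "\<sigma> \<in> {\<mu>..<\<nu>}" for t \<sigma>
    using LBINT_signal_cong[where h = f, OF eq that] LBINT_signal_cong[where h = g, OF eq that]
      eq[OF that(1)] eq[OF that(2)]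
    by (simp_all add: q_reg_def p_reg_def)
  show "Z_vec f g x u \<nu> \<mu> = Z_vec f g x' u' \<nu> \<mu>" "G_mat g x u \<nu> \<mu> = G_mat g x' u' \<nu> \<mu>"
    unfolding Z_vec_def G_mat_def
    using le by (auto intro!: interval_integral_cong simp: einterval_iff p q)
qed

text \<open>
  The flow on a sampling interval depends on the estimate and the initial state only, whereas the
  estimate depends on the whole history. Hence signals and event times are first written as explicit
  functions of an arbitrary sequence of estimates; they satisfy all conditions except the update.
  The estimates are then chosen by well-founded recursion: the update of step \<open>i\<close> refers to the
  estimates up to \<open>i\<close> only, and it is solvable because the true parameter solves its constraint.
\<close>

lemma hybrid_solution_exists:
  fixes f :: "real^'n \<Rightarrow> real^'m \<Rightarrow> real^'n"
    and g :: "real^'n \<Rightarrow> real^'m \<Rightarrow> real^'l^'n"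
    and k :: "real^'l \<Rightarrow> real^'n \<Rightarrow> real^'m"
  assumes f: "\<And>\<eta>. continuous_on UNIV (\<lambda>x. f x (k \<eta> x))"
    and g: "\<And>\<eta>. continuous_on UNIV (\<lambda>x. g x (k \<eta> x))"
    and F: "\<And>\<eta>. lipschitz_on_balls (closed_loop f g k \<theta> \<eta>)"
    and F0: "\<And>\<eta>. closed_loop f g k \<theta> \<eta> 0 = 0"
    and Vcont: "\<And>\<eta>. continuous_on UNIV (V \<eta>)" and Vbdd: "\<And>\<eta> c. bounded {x. V \<eta> x \<le> c}"
    and start: "\<And>\<eta> \<xi>. \<xi> \<noteq> 0 \<Longrightarrow> V \<eta> \<xi> < Q \<eta> \<xi> + a \<xi>"
    and T: "0 < T" and N': "0 < N'"
  shows "\<exists>x \<eta> u \<tau>. hybrid_solution f g k V Q a T N' \<theta> x \<eta> u \<tau> \<and> x 0 = x0 \<and> \<eta> 0 = \<eta>0"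
proof -
  define step where "step = (\<lambda>\<eta> \<xi> y h. 0 < h \<and> h \<le> T \<and> y 0 = \<xi> \<and>
    ode_solution (closed_loop f g k \<theta> \<eta>) {0..h} y \<and>
    (\<forall>s. ereal (s + h) = min (ereal (s + T)) (trigger_time f g k V Q a T \<theta> \<eta> s \<xi>)))"
  have "\<exists>y h. step \<eta> \<xi> y h" for \<eta> \<xi>
    unfolding step_def
    by (rule flow_until_trigger[where V = V and Q = Q and a = a and T = T, OF F F0 Vcont Vbdd start T])
  then obtain \<phi> D where "\<And>\<eta> \<xi>. step \<eta> \<xi> (\<phi> \<eta> \<xi>) (D \<eta> \<xi>)"
    by metis
  then have D: "\<And>\<eta> \<xi>. 0 < D \<eta> \<xi>" "\<And>\<eta> \<xi>. D \<eta> \<xi> \<le> T"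
    and \<phi>0: "\<And>\<eta> \<xi>. \<phi> \<eta> \<xi> 0 = \<xi>"
    and \<phi>: "\<And>\<eta> \<xi>. ode_solution (closed_loop f g k \<theta> \<eta>) {0..D \<eta> \<xi>} (\<phi> \<eta> \<xi>)"
    and trigger: "\<And>\<eta> \<xi> s. ereal (s + D \<eta> \<xi>) =
      min (ereal (s + T)) (trigger_time f g k V Q a T \<theta> \<eta> s \<xi>)"
    unfolding step_def by blast+
  define X where "X = (\<lambda>E. rec_nat x0 (\<lambda>j \<xi>. \<phi> (E j) \<xi> (D (E j) \<xi>)))"
  have X: "X E 0 = x0" "X E (Suc j) = \<phi> (E j) (X E j) (D (E j) (X E j))" for E j
    by (simp_all add: X_def)
  define \<tau> where "\<tau> = (\<lambda>E i. \<Sum>j<i. D (E j) (X E j))"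
  have \<tau>: "\<tau> E 0 = 0" "\<tau> E (Suc i) = \<tau> E i + D (E i) (X E i)" for E i
    by (simp_all add: \<tau>_def)
  have \<tau>_less: "\<tau> E i < \<tau> E (Suc i)" and \<tau>_le: "\<tau> E (Suc i) \<le> \<tau> E i + T" for E i
    using D[of "E i" "X E i"] by (simp_all add: \<tau>)
  have \<tau>_mono: "strict_mono (\<tau> E)" for E
    using \<tau>_less by (simp add: strict_mono_Suc_iff)
  \<comment> \<open>The index of the sampling interval containing \<open>t\<close>; it is determined by the event times alone.\<close>
  define idx where "idx = (\<lambda>E t. LEAST j. t < \<tau> E (Suc j))"
  have idx: "idx E t = j" if "t \<in> {\<tau> E j..<\<tau> E (Suc j)}" for E t j
    unfolding idx_def
  proof (rule Least_equality)
    fix i assume "t < \<tau> E (Suc i)"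
    then have "\<tau> E j < \<tau> E (Suc i)"
      using that by auto
    then show "j \<le> i"
      using \<tau>_mono by (simp add: strict_mono_less)
  qed (use that in simp)
  define x where "x = (\<lambda>E t. \<phi> (E (idx E t)) (X E (idx E t)) (t - \<tau> E (idx E t)))"
  define u where "u = (\<lambda>E t. k (E (idx E t)) (x E t))"
  have x_at: "x E (\<tau> E j) = X E j" for E j
    using idx[of "\<tau> E j" E j] \<tau>_less by (simp add: x_def \<phi>0)
  have x_eq: "x E t = \<phi> (E j) (X E j) (t - \<tau> E j)" if "t \<in> {\<tau> E j..\<tau> E (Suc j)}" for E t j
  proof (cases "t = \<tau> E (Suc j)")
    case True
    then show ?thesis
      using x_at[of E "Suc j"] by (simp add: X \<tau>)
  next
    case False
    then have "t \<in> {\<tau> E j..<\<tau> E (Suc j)}"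
      using that by auto
    then show ?thesis
      using idx[of t E j] by (simp add: x_def)
  qed
  have piece: "ode_solution (closed_loop f g k \<theta> (E j)) {\<tau> E j..\<tau> E (Suc j)} (x E)" for E j
  proof -
    have "ode_solution (closed_loop f g k \<theta> (E j)) {\<tau> E j..\<tau> E (Suc j)}
        (\<lambda>t. \<phi> (E j) (X E j) (t + - \<tau> E j))"
      by (rule ode_solution_shift) (use \<phi>[of "E j" "X E j"] in \<open>simp add: \<tau>\<close>)
    then show ?thesis
      unfolding ode_solution_def
      by (auto simp: x_eq intro: has_vector_derivative_transform[rotated 2])
  qed
  have loop: "sampled_loop f g k \<theta> (x E) (u E) (\<tau> E) E" for E
    unfolding sampled_loop_def
  proof (intro conjI allI ballI)
    show "\<tau> E 0 = 0" "\<And>i. \<tau> E i < \<tau> E (Suc i)"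
      using \<tau> \<tau>_less by auto
    show "continuous_on {0..\<tau> E i} (x E)" for i
    proof (induction i)
      case 0
      then show ?case by (simp add: \<tau>)
    next
      case (Suc i)
      have "0 \<le> \<tau> E i"
        using strict_mono_leD[OF \<tau>_mono, of 0 i E] by (simp add: \<tau>(1))
      then have "{0..\<tau> E (Suc i)} = {0..\<tau> E i} \<union> {\<tau> E i..\<tau> E (Suc i)}"
        using \<tau>_less[of E i] by auto
      then show ?case
        using continuous_on_closed_Un[OF _ _ Suc ode_solution_imp_continuous_on[OF piece]] by simp
    qed
    fix i t assume t: "t \<in> {\<tau> E i..<\<tau> E (Suc i)}"
    show ut: "u E t = k (E i) (x E t)"
      using idx[OF t] by (simp add: u_def)
    have "ode_solution (closed_loop f g k \<theta> (E i)) {\<tau> E i..<\<tau> E (Suc i)} (x E)"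
      by (rule ode_solution_subset[OF piece]) auto
    then show "(x E has_vector_derivative f (x E t) (u E t) + g (x E t) (u E t) *v \<theta>)
        (at t within {\<tau> E i..<\<tau> E (Suc i)})"
      using t by (simp add: ode_solution_def closed_loop_def ut)
  qed
  define update where "update = (\<lambda>E i r.
    is_arg_min (\<lambda>\<zeta>. (norm (\<zeta> - E i))\<^sup>2)
      (\<lambda>\<zeta>. Z_vec f g (x E) (u E) (\<tau> E (Suc i)) (window_start T N' (\<tau> E) i) =
           G_mat g (x E) (u E) (\<tau> E (Suc i)) (window_start T N' (\<tau> E) i) *v \<zeta>) r)"
  \<comment> \<open>Through \<open>G\<close> and \<open>Z\<close> the update looks at the window only up to \<open>\<tau> (Suc i)\<close>, where the input is
    still the one computed from \<open>E i\<close>.\<close>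
  have causal: "update E i r \<longleftrightarrow> update E' i r" if agree: "\<And>j. j \<le> i \<Longrightarrow> E j = E' j" for E E' i r
  proof -
    have X_eq: "X E j = X E' j" if "j \<le> Suc i" for j
      using that by (induction j) (simp_all add: X agree)
    have \<tau>_eq: "\<tau> E j = \<tau> E' j" if "j \<le> Suc i" for j
      using that by (induction j) (simp_all add: \<tau> X_eq agree)
    have window: "window_start T N' (\<tau> E) i = window_start T N' (\<tau> E') i"
      unfolding window_start_def using \<tau>_eq
      by (intro arg_cong[of _ _ Min] Collect_cong ex_cong1) auto
    obtain j where j: "j \<le> i" "window_start T N' (\<tau> E) i = \<tau> E j"
      using window_start_eq[of "\<tau> E" i T N'] \<tau>_le T N' by blast
    have \<mu>: "0 \<le> \<tau> E j" "\<tau> E j \<le> \<tau> E (Suc i)"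
      using strict_mono_leD[OF \<tau>_mono, of 0 j E] strict_mono_leD[OF \<tau>_mono, of j "Suc i" E] j(1)
      by (simp_all add: \<tau>(1))
    have signals: "x E s = x E' s \<and> u E s = u E' s" if s: "s \<in> {\<tau> E j..<\<tau> E (Suc i)}" for s
    proof -
      obtain l where l: "l < Suc i" "s \<in> {\<tau> E l..<\<tau> E (Suc l)}"
        using sampled_loop_interval[OF loop, of s E "Suc i"] s \<mu> by auto
      then have "idx E s = l" "idx E' s = l"
        using idx[of s E l] idx[of s E' l] \<tau>_eq[of l] \<tau>_eq[of "Suc l"] by auto
      then show ?thesis
        using l(1) by (simp add: u_def x_def X_eq \<tau>_eq agree)
    qed
    have "Z_vec f g (x E) (u E) (\<tau> E (Suc i)) (\<tau> E j) = Z_vec f g (x E') (u E') (\<tau> E (Suc i)) (\<tau> E j)"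
      "G_mat g (x E) (u E) (\<tau> E (Suc i)) (\<tau> E j) = G_mat g (x E') (u E') (\<tau> E (Suc i)) (\<tau> E j)"
      by (rule Z_vec_G_mat_cong[OF signals \<mu>(2)]; assumption)+
    then show ?thesis
      unfolding update_def window[symmetric] j(2) \<tau>_eq[OF order_refl, symmetric]
      using agree[of i] by simp
  qed
  have possible: "\<exists>r. update E i r" for E i
  proof -
    obtain j where j: "j \<le> i" "window_start T N' (\<tau> E) i = \<tau> E j"
      using window_start_eq[of "\<tau> E" i T N'] \<tau>_le T N' by blast
    have \<mu>: "0 \<le> \<tau> E j" "\<tau> E j < \<tau> E (Suc i)"
      using strict_mono_leD[OF \<tau>_mono, of 0 j E] strict_monoD[OF \<tau>_mono, of j "Suc i" E] j(1)
      by (simp_all add: \<tau>(1))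
    have "Z_vec f g (x E) (u E) (\<tau> E (Suc i)) (\<tau> E j) =
        G_mat g (x E) (u E) (\<tau> E (Suc i)) (\<tau> E j) *v \<theta>"
      by (rule true_parameter_solves_normal_equation[OF loop f g \<mu> order_refl])
    then show ?thesis
      unfolding update_def j(2) by (rule least_change_solution_exists)
  qed
  have "\<exists>E. \<forall>n. (case n of 0 \<Rightarrow> E n = \<eta>0 | Suc i \<Rightarrow> update E i (E n))"
  proof (rule dependent_wf_choice[OF wf_less_than,
        of "\<lambda>E n r. case n of 0 \<Rightarrow> r = \<eta>0 | Suc i \<Rightarrow> update E i r"])
    fix E E' :: "nat \<Rightarrow> real^'l" and n r
    assume "\<And>z. (z, n) \<in> less_than \<Longrightarrow> E z = E' z"
    then show "(case n of 0 \<Rightarrow> r = \<eta>0 | Suc i \<Rightarrow> update E i r) =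
        (case n of 0 \<Rightarrow> r = \<eta>0 | Suc i \<Rightarrow> update E' i r)"
      by (cases n) (auto intro!: causal)
  next
    fix n and E :: "nat \<Rightarrow> real^'l"
    show "\<exists>r. case n of 0 \<Rightarrow> r = \<eta>0 | Suc i \<Rightarrow> update E i r"
      using possible by (cases n) auto
  qed
  then obtain E where E: "\<And>n. case n of 0 \<Rightarrow> E n = \<eta>0 | Suc i \<Rightarrow> update E i (E n)"
    by blast
  have E0: "E 0 = \<eta>0" and ES: "update E i (E (Suc i))" for i
    using E[of 0] E[of "Suc i"] by simp_all
  define \<eta> where "\<eta> = (\<lambda>t. E (idx E t))"
  have \<eta>: "\<eta> t = E i" if "t \<in> {\<tau> E i..<\<tau> E (Suc i)}" for t i
    using idx[OF that] by (simp add: \<eta>_def)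
  have \<eta>_at: "\<eta> (\<tau> E i) = E i" for i
    using \<eta> \<tau>_less by simp
  have "hybrid_solution f g k V Q a T N' \<theta> (x E) \<eta> (u E) (\<tau> E)"
    unfolding hybrid_solution_iff \<eta>_at
    using loop \<eta> trigger ES by (simp add: \<tau> x_at update_def)
  moreover have "x E 0 = x0" "\<eta> 0 = \<eta>0"
    using x_at[of E 0] \<eta>_at[of 0] by (simp_all add: \<tau>(1) X E0)
  ultimately show ?thesis
    by blast
qed

section \<open>Behaviour of hybrid solutions\<close>

lemma hybrid_solution_step:
  assumes "hybrid_solution f g k V Q a T N' \<theta> x \<eta> u \<tau>"
  shows "\<tau> (Suc i) \<le> \<tau> i + T"
    and "ereal (\<tau> (Suc i)) \<le> trigger_time f g k V Q a T \<theta> (\<eta> (\<tau> i)) (\<tau> i) (x (\<tau> i))"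
proof -
  have step: "ereal (\<tau> (Suc i)) =
      min (ereal (\<tau> i + T)) (trigger_time f g k V Q a T \<theta> (\<eta> (\<tau> i)) (\<tau> i) (x (\<tau> i)))"
    using assms unfolding hybrid_solution_iff by blast
  have "ereal (\<tau> (Suc i)) \<le> ereal (\<tau> i + T)"
    unfolding step by (rule min.cobounded1)
  then show "\<tau> (Suc i) \<le> \<tau> i + T"
    by simp
  show "ereal (\<tau> (Suc i)) \<le> trigger_time f g k V Q a T \<theta> (\<eta> (\<tau> i)) (\<tau> i) (x (\<tau> i))"
    unfolding step by (rule min.cobounded2)
qed

lemma hybrid_solution_times_le:
  assumes "hybrid_solution f g k V Q a T N' \<theta> x \<eta> u \<tau>"
  shows "\<tau> i \<le> real i * T"
proof (induction i)
  case 0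
  have "\<tau> 0 = 0"
    using assms by (simp add: hybrid_solution_def)
  then show ?case
    by simp
next
  case (Suc i)
  then show ?case
    using hybrid_solution_step(1)[OF assms, of i] by (simp add: algebra_simps)
qed

lemma hybrid_solution_step_eq:
  assumes "hybrid_solution f g k V Q a T N' \<theta> x \<eta> u \<tau>"
    and "ereal (\<tau> i + T) \<le> trigger_time f g k V Q a T \<theta> (\<eta> (\<tau> i)) (\<tau> i) (x (\<tau> i))"
  shows "\<tau> (Suc i) = \<tau> i + T"
proof -
  have step: "ereal (\<tau> (Suc i)) =
      min (ereal (\<tau> i + T)) (trigger_time f g k V Q a T \<theta> (\<eta> (\<tau> i)) (\<tau> i) (x (\<tau> i)))"
    using assms(1) unfolding hybrid_solution_iff by blast
  then show ?thesis
    using min.absorb1[OF assms(2)] by simp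
qed

text \<open>
  Exceeding the level before the next event would, by the intermediate value theorem, require a
  crossing that had triggered the event already.
\<close>

lemma hybrid_solution_level_bound:
  assumes hyb: "hybrid_solution f g k V Q a T N' \<theta> x \<eta> u \<tau>"
    and Vcont: "continuous_on UNIV (V (\<eta> (\<tau> i)))"
    and start: "V (\<eta> (\<tau> i)) (x (\<tau> i)) < Q (\<eta> (\<tau> i)) (x (\<tau> i)) + a (x (\<tau> i))"
    and nz: "x (\<tau> i) \<noteq> 0" and t: "t \<in> {\<tau> i..\<tau> (Suc i)}"
  shows "V (\<eta> (\<tau> i)) (x t) \<le> Q (\<eta> (\<tau> i)) (x (\<tau> i)) + a (x (\<tau> i))"
proof -
  let ?F = "closed_loop f g k \<theta> (\<eta> (\<tau> i))"
  define c where "c = Q (\<eta> (\<tau> i)) (x (\<tau> i)) + a (x (\<tau> i))"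
  define W where "W = (\<lambda>t. V (\<eta> (\<tau> i)) (x t))"
  have S: "sampled_loop f g k \<theta> x u \<tau> (\<lambda>i. \<eta> (\<tau> i))"
    using hyb by (simp add: hybrid_solution_iff)
  have times: "0 \<le> \<tau> i" "\<tau> i < \<tau> (Suc i)"
    using sampled_loop_times(2)[OF S] sampled_loopD(2)[OF S] by auto
  have "continuous_on {\<tau> i..\<tau> (Suc i)} x"
    using sampled_loopD(3)[OF S, of "Suc i"] by (rule continuous_on_subset) (use times in auto)
  then have Wcont: "continuous_on {\<tau> i..\<tau> (Suc i)} W"
    unfolding W_def by (intro continuous_on_compose2[OF Vcont]) auto
  show ?thesis
  proof (rule ccontr)
    assume "\<not> ?thesis"
    then have above: "c < W t"
      by (simp add: c_def W_def)
    have "W (\<tau> i) < c"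
      using start by (simp add: c_def W_def)
    moreover have "continuous_on {\<tau> i..t} W"
      using Wcont by (rule continuous_on_subset) (use t in auto)
    ultimately obtain r where r: "\<tau> i \<le> r" "r \<le> t" "W r = c"
      using IVT'[of W "\<tau> i" c t] above t by auto
    have strict: "\<tau> i < r" "r < t"
      using r above \<open>W (\<tau> i) < c\<close> by (auto simp: less_le)
    have "ode_solution ?F {\<tau> i..r} x"
      using sampled_loop_ode_solution[OF S, of i]
      by (rule ode_solution_subset) (use strict t in auto)
    then have "trigger_time f g k V Q a T \<theta> (\<eta> (\<tau> i)) (\<tau> i) (x (\<tau> i)) \<le> ereal r"
      unfolding trigger_time_def using nz strict(1) r(3)
      by (auto intro!: Inf_lower simp: W_def c_def)
    then have "ereal (\<tau> (Suc i)) \<le> ereal r"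
      using hybrid_solution_step(2)[OF hyb, of i] by (rule order_trans[rotated])
    then show False
      using strict(2) t by simp
  qed
qed

text \<open>
  From the equilibrium no event is triggered by the level, and the state stays there by uniqueness.
\<close>

lemma hybrid_solution_rest:
  assumes hyb: "hybrid_solution f g k V Q a T N' \<theta> x \<eta> u \<tau>"
    and F: "lipschitz_on_balls (closed_loop f g k \<theta> (\<eta> (\<tau> i)))"
    and F0: "closed_loop f g k \<theta> (\<eta> (\<tau> i)) 0 = 0"
    and zero: "x (\<tau> i) = 0"
  shows "t \<in> {\<tau> i..\<tau> (Suc i)} \<Longrightarrow> x t = 0" and "\<tau> (Suc i) = \<tau> i + T"
proof -
  have S: "sampled_loop f g k \<theta> x u \<tau> (\<lambda>i. \<eta> (\<tau> i))"
    using hyb by (simp add: hybrid_solution_iff)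
  have times: "0 \<le> \<tau> i" "\<tau> i < \<tau> (Suc i)"
    using sampled_loop_times(2)[OF S] sampled_loopD(2)[OF S] by auto
  have "continuous_on {\<tau> i..\<tau> (Suc i)} x"
    using sampled_loopD(3)[OF S, of "Suc i"] by (rule continuous_on_subset) (use times in auto)
  moreover have "ode_solution (closed_loop f g k \<theta> (\<eta> (\<tau> i))) {\<tau> i..<\<tau> (Suc i)} (\<lambda>_. 0)"
    by (simp add: ode_solution_def F0)
  ultimately show "x t = 0" if "t \<in> {\<tau> i..\<tau> (Suc i)}"
    using ode_solution_unique[OF F _ sampled_loop_ode_solution[OF S] continuous_on_const _ zero that]
    by simp
  show "\<tau> (Suc i) = \<tau> i + T"
    by (rule hybrid_solution_step_eq[OF hyb]) (simp add: trigger_time_def zero)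
qed

text \<open>
  The new error lies in the kernel of the Gramian and is not larger than the old one. In particular,
  once the estimate is exact it stays exact.
\<close>

lemma hybrid_solution_estimate_error:
  fixes f :: "real^'n \<Rightarrow> real^'m \<Rightarrow> real^'n"
    and g :: "real^'n \<Rightarrow> real^'m \<Rightarrow> real^'l^'n"
  assumes hyb: "hybrid_solution f g k V Q a T N' \<theta> x \<eta> u \<tau>"
    and f: "\<And>\<eta>. continuous_on UNIV (\<lambda>x. f x (k \<eta> x))"
    and g: "\<And>\<eta>. continuous_on UNIV (\<lambda>x. g x (k \<eta> x))"
    and T: "0 < T" and N': "0 < N'"
  shows "0 \<le> window_start T N' \<tau> i"
    and "G_mat g x u (\<tau> (Suc i)) (window_start T N' \<tau> i) *v (\<eta> (\<tau> (Suc i)) - \<theta>) = 0"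
    and "norm (\<eta> (\<tau> (Suc i)) - \<theta>) \<le> norm (\<eta> (\<tau> i) - \<theta>)"
proof -
  have S: "sampled_loop f g k \<theta> x u \<tau> (\<lambda>i. \<eta> (\<tau> i))"
    using hyb by (simp add: hybrid_solution_iff)
  obtain j where j: "j \<le> i" "window_start T N' \<tau> i = \<tau> j"
    using window_start_eq[of \<tau> i T N', OF hybrid_solution_step(1)[OF hyb] T N'] by blast
  have \<mu>: "0 \<le> \<tau> j" "\<tau> j < \<tau> (Suc i)"
    using sampled_loop_times[OF S] j(1) by (auto simp: strict_mono_less)
  then show "0 \<le> window_start T N' \<tau> i"
    by (simp add: j(2))
  note normal = true_parameter_solves_normal_equation[OF S f g \<mu> order_refl]
  have "is_arg_min (\<lambda>\<zeta>. (norm (\<zeta> - \<eta> (\<tau> i)))\<^sup>2)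
      (\<lambda>\<zeta>. Z_vec f g x u (\<tau> (Suc i)) (\<tau> j) = G_mat g x u (\<tau> (Suc i)) (\<tau> j) *v \<zeta>) (\<eta> (\<tau> (Suc i)))"
    using hyb unfolding hybrid_solution_iff j(2)[symmetric] by blast
  note error = least_change_solution_error[OF this normal]
  show "G_mat g x u (\<tau> (Suc i)) (window_start T N' \<tau> i) *v (\<eta> (\<tau> (Suc i)) - \<theta>) = 0"
    using error(1) by (simp add: j(2))
  show "norm (\<eta> (\<tau> (Suc i)) - \<theta>) \<le> norm (\<eta> (\<tau> i) - \<theta>)"
    by (rule error(2))
qed

lemma hybrid_solution_estimate_error_antimono:
  fixes f :: "real^'n \<Rightarrow> real^'m \<Rightarrow> real^'n"
    and g :: "real^'n \<Rightarrow> real^'m \<Rightarrow> real^'l^'n"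
  assumes hyb: "hybrid_solution f g k V Q a T N' \<theta> x \<eta> u \<tau>"
    and f: "\<And>\<eta>. continuous_on UNIV (\<lambda>x. f x (k \<eta> x))"
    and g: "\<And>\<eta>. continuous_on UNIV (\<lambda>x. g x (k \<eta> x))"
    and T: "0 < T" and N': "0 < N'" and ij: "i \<le> j"
  shows "norm (\<eta> (\<tau> j) - \<theta>) \<le> norm (\<eta> (\<tau> i) - \<theta>)"
  using hybrid_solution_estimate_error(3)[OF hyb f g T N'] ij
  by (rule lift_Suc_antimono_le)

text \<open>
  Regularity of the trajectory in the form that the observability hypothesis (iii) asks for.
\<close>

lemma sampled_loop_C1:
  fixes f :: "real^'n \<Rightarrow> real^'m \<Rightarrow> real^'n"
    and g :: "real^'n \<Rightarrow> real^'m \<Rightarrow> real^'l^'n"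
  assumes S: "sampled_loop f g k \<theta> x u \<tau> E"
    and f: "\<And>\<eta>. continuous_on UNIV (\<lambda>x. f x (k \<eta> x))"
    and g: "\<And>\<eta>. continuous_on UNIV (\<lambda>x. g x (k \<eta> x))"
  shows "x C1_differentiable_on ({0..\<tau> n} - \<tau> ` {0..n})"
proof -
  let ?D = "\<lambda>t. f (x t) (u t) + g (x t) (u t) *v \<theta>"
  have "(x has_vector_derivative ?D t) (at t) \<and> isCont ?D t"
    if t: "t \<in> {0..\<tau> n} - \<tau> ` {0..n}" for t
  proof -
    have "t \<noteq> \<tau> n"
      using t by auto
    then obtain j where j: "j < n" "t \<in> {\<tau> j..<\<tau> (Suc j)}"
      using sampled_loop_interval[OF S, of t n] t by auto
    have open_piece: "t \<in> {\<tau> j<..<\<tau> (Suc j)}"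
      using j t by (auto simp: less_le)
    have "0 \<le> \<tau> j"
      by (rule sampled_loop_times(2)[OF S])
    then have xcont: "continuous_on {\<tau> j<..<\<tau> (Suc j)} x"
      using sampled_loopD(3)[OF S, of "Suc j"] by (rule_tac continuous_on_subset) auto
    have "continuous_on {\<tau> j<..<\<tau> (Suc j)}
        (\<lambda>t. f (x t) (k (E j) (x t)) + g (x t) (k (E j) (x t)) *v \<theta>)"
      by (intro continuous_on_add bounded_linear.continuous_on[OF bounded_linear_matrix_vector_mult_left]
          continuous_on_compose2[OF f xcont] continuous_on_compose2[OF g xcont]) auto
    then have "continuous_on {\<tau> j<..<\<tau> (Suc j)} ?D"
      by (rule continuous_on_eq) (use sampled_loopD(5)[OF S, where i = j] in auto)
    then have "isCont ?D t"
      using open_piece by (simp add: continuous_on_eq_continuous_at)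
    moreover have "(x has_vector_derivative ?D t) (at t)"
      using has_vector_derivative_halfopen_imp_at[OF sampled_loopD(4)[OF S j(2)]] open_piece by simp
    ultimately show ?thesis
      by blast
  qed
  then show ?thesis
    unfolding C1_differentiable_on_def
    by (intro exI[of _ ?D] conjI ballI continuous_at_imp_continuous_on) auto
qed

text \<open>
  If the estimate were still wrong at \<open>\<tau> N\<close>, it would have been wrong at all earlier events. The first
  \<open>N\<close> windows start at time 0, since \<open>\<tau> N \<le> N T \<le> N' T\<close>, so every one of these nonzero errors is
  invisible along the whole trajectory seen so far. This is the situation of hypothesis (iii), which
  forces the trajectory to vanish.
\<close>

lemma finite_time_identification:
  fixes f :: "real^'n \<Rightarrow> real^'m \<Rightarrow> real^'n"
    and g :: "real^'n \<Rightarrow> real^'m \<Rightarrow> real^'l^'n"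
  assumes hyb: "hybrid_solution f g k V Q a T N' \<theta> x \<eta> u \<tau>"
    and f: "\<And>\<eta>. continuous_on UNIV (\<lambda>x. f x (k \<eta> x))"
    and g: "\<And>\<eta>. continuous_on UNIV (\<lambda>x. g x (k \<eta> x))"
    and T: "0 < T" and N': "N < N'"
    and observable: "\<forall>(\<tau> :: nat \<Rightarrow> real) (\<theta> :: real^'l) (d :: nat \<Rightarrow> real^'l) (x :: real \<Rightarrow> real^'n).
        \<tau> 0 = 0 \<and> (\<forall>i<N. \<tau> i < \<tau> (Suc i)) \<and> (\<forall>i\<le>N. d i \<noteq> 0) \<and>
        continuous_on {0..\<tau> N} x \<and> x C1_differentiable_on ({0..\<tau> N} - \<tau> ` {0..N}) \<and>
        (\<forall>i<N. \<forall>t\<in>{\<tau> i..<\<tau> (Suc i)}.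
           (x has_vector_derivative closed_loop f g k \<theta> (\<theta> + d i) (x t))
             (at t within {\<tau> i..<\<tau> (Suc i)})) \<and>
        (\<forall>i<N. \<forall>j\<le>i. \<forall>t\<in>{\<tau> j..\<tau> (Suc j)}. g (x t) (k (\<theta> + d j) (x t)) *v d (Suc i) = 0)
        \<longrightarrow> (\<forall>t\<in>{0..\<tau> N}. x t = 0)"
    and nz: "x 0 \<noteq> 0"
  shows "\<eta> (\<tau> N) = \<theta>"
proof (rule ccontr)
  assume wrong: "\<eta> (\<tau> N) \<noteq> \<theta>"
  have S: "sampled_loop f g k \<theta> x u \<tau> (\<lambda>i. \<eta> (\<tau> i))"
    using hyb by (simp add: hybrid_solution_iff)
  have N'0: "0 < N'"
    using N' by simp
  \<comment> \<open>In the notation of (iii), the controller parameter on the interval \<open>i\<close> is \<open>\<theta> + d i\<close>.\<close>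
  define d where "d = (\<lambda>i. \<eta> (\<tau> i) - \<theta>)"
  have d_nz: "d i \<noteq> 0" if "i \<le> N" for i
    using hybrid_solution_estimate_error_antimono[OF hyb f g T N'0 that] wrong
    by (auto simp: d_def)
  have window: "window_start T N' \<tau> i \<le> \<tau> 0" if "i < N" for i
  proof (rule window_start_le)
    have "\<tau> (Suc i) \<le> real (Suc i) * T"
      by (rule hybrid_solution_times_le[OF hyb])
    also have "\<dots> \<le> real N' * T"
      using that N' T by (intro mult_right_mono) auto
    finally show "\<tau> (Suc i) - real N' * T \<le> \<tau> 0"
      using sampled_loopD(1)[OF S] by simp
  qed simp
  have "g (x t) (k (\<theta> + d j) (x t)) *v d (Suc i) = 0"
    if "i < N" "j \<le> i" "t \<in> {\<tau> j..\<tau> (Suc j)}" for i j t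
  proof -
    have "window_start T N' \<tau> i \<le> \<tau> j"
      using window[OF that(1)] sampled_loop_times(2)[OF S, of j] sampled_loopD(1)[OF S] by linarith
    then have "g (x t) (k (\<eta> (\<tau> j)) (x t)) *v (\<eta> (\<tau> (Suc i)) - \<theta>) = 0"
      by (rule gramian_kernel[OF S g hybrid_solution_estimate_error(1)[OF hyb f g T N'0] _ that(2)
            hybrid_solution_estimate_error(2)[OF hyb f g T N'0] that(3)])
    then show ?thesis
      by (simp add: d_def)
  qed
  moreover have "(x has_vector_derivative closed_loop f g k \<theta> (\<theta> + d i) (x t))
      (at t within {\<tau> i..<\<tau> (Suc i)})" if "t \<in> {\<tau> i..<\<tau> (Suc i)}" for i t
    using sampled_loop_ode_solution[OF S, of i] that by (simp add: ode_solution_def d_def)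
  ultimately have "\<forall>t\<in>{0..\<tau> N}. x t = 0"
    using d_nz sampled_loopD(1-3)[OF S] sampled_loop_C1[OF S f g]
    by (intro mp[OF spec[OF spec[OF spec[OF spec[OF observable, of \<tau>], of \<theta>], of d], of x]]
        conjI allI impI ballI) blast+
  moreover have "0 \<in> {0..\<tau> N}"
    using sampled_loop_times(2)[OF S] by simp
  ultimately show False
    using nz by blast
qed

text \<open>
  With the exact estimate, uniqueness identifies every solution with a nominal one, on which
  \<open>V \<le> Q \<xi> < Q \<xi> + a \<xi>\<close>: the level is never reached.
\<close>

lemma certainty_equivalence_no_trigger:
  fixes f :: "real^'n \<Rightarrow> real^'m \<Rightarrow> real^'n"
  assumes F: "lipschitz_on_balls (closed_loop f g k \<theta> \<theta>)"
    and gas: "globally_asymptotically_stable (closed_loop f g k \<theta> \<theta>)"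
    and bound: "\<forall>x. ode_solution (closed_loop f g k \<theta> \<theta>) {0..} x \<longrightarrow>
                    (\<forall>t\<ge>0. V \<theta> (x t) \<le> Q \<theta> (x 0))"
    and a: "\<xi> \<noteq> 0 \<Longrightarrow> 0 < a \<xi>"
  shows "ereal (s + T) \<le> trigger_time f g k V Q a T \<theta> \<theta> s \<xi>"
proof (cases "\<xi> = 0")
  case True
  then show ?thesis by (simp add: trigger_time_def)
next
  case False
  let ?F = "closed_loop f g k \<theta> \<theta>"
  obtain z where z: "ode_solution ?F {0..} z" "z 0 = \<xi>"
    using gas unfolding globally_asymptotically_stable_def by blast
  have "V \<theta> (y t) \<noteq> Q \<theta> \<xi> + a \<xi>"
    if t: "s < t" and y: "ode_solution ?F {s..t} y" "y s = \<xi>" for t y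
  proof -
    have y': "ode_solution ?F {0..t - s} (\<lambda>r. y (r + s))"
      by (rule ode_solution_shift) (use y in simp)
    have z': "ode_solution ?F {0..t - s} z"
      using z(1) by (rule ode_solution_subset) auto
    have "y (t - s + s) = z (t - s)"
      by (rule ode_solution_unique[OF F ode_solution_imp_continuous_on[OF y'] _
            ode_solution_imp_continuous_on[OF z']])
        (use t y(2) z(2) y' z' in \<open>auto intro: ode_solution_subset\<close>)
    then have "V \<theta> (y t) \<le> Q \<theta> \<xi>"
      using bound z t by auto
    then show ?thesis
      using a[OF False] by simp
  qed
  then have no_hit: "{t. s < t \<and> (\<exists>y. ode_solution ?F {s..t} y \<and> y s = \<xi> \<and> V \<theta> (y t) = Q \<theta> \<xi> + a \<xi>)} = {}"
    by blast
  show ?thesis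
    unfolding trigger_time_def no_hit using False by (simp add: top_ereal_def)
qed

text \<open>
  Uniqueness on each sampling interval glues the pieces into one nominal solution; the bound of
  hypothesis (iv) is then applied once, and not once per interval, which would multiply the constants.
\<close>

lemma hybrid_solution_follows_nominal:
  assumes hyb: "hybrid_solution f g k V Q a T N' \<theta> x \<eta> u \<tau>"
    and F: "lipschitz_on_balls (closed_loop f g k \<theta> \<theta>)"
    and z: "ode_solution (closed_loop f g k \<theta> \<theta>) {0..} z" "z 0 = x (\<tau> n)"
    and \<eta>: "\<And>i. n \<le> i \<Longrightarrow> \<eta> (\<tau> i) = \<theta>"
    and t: "t \<in> {\<tau> n..\<tau> (n + j)}"
  shows "x t = z (t - \<tau> n)"
  using t
proof (induction j arbitrary: t)
  case 0
  then show ?case using z(2) by simp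
next
  case (Suc j)
  let ?F = "closed_loop f g k \<theta> \<theta>" and ?i = "n + j"
  have S: "sampled_loop f g k \<theta> x u \<tau> (\<lambda>i. \<eta> (\<tau> i))"
    using hyb by (simp add: hybrid_solution_iff)
  have times: "0 \<le> \<tau> ?i" "\<tau> n \<le> \<tau> ?i"
    using sampled_loop_times[OF S] by (auto simp: strict_mono_less_eq)
  show ?case
  proof (cases "t \<le> \<tau> ?i")
    case True
    then show ?thesis using Suc by auto
  next
    case False
    have shifted: "ode_solution ?F {\<tau> n..} (\<lambda>r. z (r + - \<tau> n))"
    proof (rule ode_solution_shift)
      have "(\<lambda>r. r + - \<tau> n) ` {\<tau> n..} \<subseteq> {0..}"
        by auto
      then show "ode_solution ?F ((\<lambda>r. r + - \<tau> n) ` {\<tau> n..}) z"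
        by (rule ode_solution_subset[OF z(1)])
    qed
    have "x t = z (t + - \<tau> n)"
    proof (rule ode_solution_unique[OF F, of "\<tau> ?i" "\<tau> (Suc ?i)" x "\<lambda>r. z (r + - \<tau> n)" t])
      show "continuous_on {\<tau> ?i..\<tau> (Suc ?i)} x"
        using sampled_loopD(3)[OF S, of "Suc ?i"] by (rule continuous_on_subset) (use times in auto)
      show "ode_solution ?F {\<tau> ?i..<\<tau> (Suc ?i)} x"
        using sampled_loop_ode_solution[OF S, of ?i] \<eta> by simp
      show "continuous_on {\<tau> ?i..\<tau> (Suc ?i)} (\<lambda>r. z (r + - \<tau> n))"
        by (rule ode_solution_imp_continuous_on, rule ode_solution_subset[OF shifted]) (use times in auto)
      show "ode_solution ?F {\<tau> ?i..<\<tau> (Suc ?i)} (\<lambda>r. z (r + - \<tau> n))"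
        by (rule ode_solution_subset[OF shifted]) (use times in auto)
      show "x (\<tau> ?i) = z (\<tau> ?i + - \<tau> n)"
        using Suc.IH[of "\<tau> ?i"] times by simp
      show "t \<in> {\<tau> ?i..\<tau> (Suc ?i)}"
        using Suc.prems False by simp
    qed
    then show ?thesis
      by simp
  qed
qed

lemma eventually_equidistant_unbounded:
  fixes \<tau> :: "nat \<Rightarrow> real"
  assumes "\<And>i. n \<le> i \<Longrightarrow> \<tau> (Suc i) = \<tau> i + T" and "0 < T"
  shows "\<exists>i\<ge>n. t < \<tau> i"
proof -
  have "\<tau> (n + j) = \<tau> n + real j * T" for j
    by (induction j) (simp_all add: assms(1) algebra_simps)
  moreover obtain j where "t - \<tau> n < real j * T"
    using reals_Archimedean3[OF assms(2)] by blast
  ultimately have "t < \<tau> (n + j)"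
    by simp
  then show ?thesis
    by (intro exI[of _ "n + j"]) simp
qed

section \<open>Exponential convergence\<close>

theorem theorem4p3:
  fixes f :: "real^'n \<Rightarrow> real^'m \<Rightarrow> real^'n"
    and g :: "real^'n \<Rightarrow> real^'m \<Rightarrow> real^'l^'n"
    and k :: "real^'l \<Rightarrow> real^'n \<Rightarrow> real^'m"
    and V Q :: "real^'l \<Rightarrow> real^'n \<Rightarrow> real"
    and M \<omega> :: "real^'l \<Rightarrow> real"
    and a :: "real^'n \<Rightarrow> real"
    and T :: real
    and N N' :: nat
  assumes f_smooth: "smooth_map (\<lambda>(x, u). f x u)" and f_zero: "f 0 0 = 0"
    and g_smooth: "smooth_map (\<lambda>(x, u). g x u)" and g_zero: "g 0 0 = 0"
    and k_smooth: "smooth_map (\<lambda>(\<theta>, x). k \<theta> x)" and k_zero: "\<forall>\<theta>. k \<theta> 0 = 0"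
    and V_pos: "\<forall>\<theta>. positive_definite (V \<theta>) \<and> radially_unbounded (V \<theta>)"
    and Q_pos: "\<forall>\<theta>. positive_definite (Q \<theta>) \<and> radially_unbounded (Q \<theta>)"
    and V_cont: "continuous_on UNIV (\<lambda>(\<theta>, x). V \<theta> x)"
    and Q_cont: "continuous_on UNIV (\<lambda>(\<theta>, x). Q \<theta> x)"
    and i_gas: "\<forall>\<theta>. globally_asymptotically_stable (closed_loop f g k \<theta> \<theta>)"
    and i_bound: "\<forall>\<theta> x. ode_solution (closed_loop f g k \<theta> \<theta>) {0..} x \<longrightarrow>
                    (\<forall>t\<ge>0. V \<theta> (x t) \<le> Q \<theta> (x 0))"
    and ii: "\<forall>\<Theta>. \<Theta> \<noteq> {} \<and> compact \<Theta> \<longrightarrow>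
               (\<forall>B\<ge>0. \<exists>R>0. \<forall>\<theta>\<in>\<Theta>. \<forall>x. V \<theta> x \<le> B \<longrightarrow> norm x \<le> R)"
    and N_pos: "N > 0"
    and iii: "\<forall>(\<tau> :: nat \<Rightarrow> real) (\<theta> :: real^'l) (d :: nat \<Rightarrow> real^'l) (x :: real \<Rightarrow> real^'n).
        \<tau> 0 = 0 \<and> (\<forall>i<N. \<tau> i < \<tau> (Suc i)) \<and> (\<forall>i\<le>N. d i \<noteq> 0) \<and>
        continuous_on {0..\<tau> N} x \<and> x C1_differentiable_on ({0..\<tau> N} - \<tau> ` {0..N}) \<and>
        (\<forall>i<N. \<forall>t\<in>{\<tau> i..<\<tau> (Suc i)}.
           (x has_vector_derivative closed_loop f g k \<theta> (\<theta> + d i) (x t))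
             (at t within {\<tau> i..<\<tau> (Suc i)})) \<and>
        (\<forall>i<N. \<forall>j\<le>i. \<forall>t\<in>{\<tau> j..\<tau> (Suc j)}. g (x t) (k (\<theta> + d j) (x t)) *v d (Suc i) = 0)
        \<longrightarrow> (\<forall>t\<in>{0..\<tau> N}. x t = 0)"
    and iv_pos: "\<forall>\<theta>. M \<theta> > 0 \<and> \<omega> \<theta> > 0"
    and iv: "\<forall>\<theta> x. ode_solution (closed_loop f g k \<theta> \<theta>) {0..} x \<longrightarrow>
               (\<forall>t\<ge>0. norm (x t) \<le> M \<theta> * exp (- \<omega> \<theta> * t) * norm (x 0))"
    and v: "\<forall>\<Theta>. \<Theta> \<noteq> {} \<and> compact \<Theta> \<longrightarrow>
              (\<exists>K1 K2. 0 < K1 \<and> K1 < K2 \<and>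
                 (\<forall>\<theta>\<in>\<Theta>. \<forall>x. K1 * (norm x)\<^sup>2 \<le> V \<theta> x \<and> V \<theta> x \<le> Q \<theta> x \<and> Q \<theta> x \<le> K2 * (norm x)\<^sup>2))"
    and T_pos: "T > 0"
    and a_cont: "continuous_on UNIV a" and a_pos: "positive_definite a"
    and a_sup: "bdd_above ((\<lambda>x. a x / (norm x)\<^sup>2) ` (UNIV - {0}))"
    and N'_gt: "N' > N"
  shows "\<exists>M' :: real^'l \<Rightarrow> real^'l \<Rightarrow> real.
      (\<forall>\<theta> \<eta>0. M' \<theta> \<eta>0 > 0) \<and>
      (\<forall>\<theta> x0 \<eta>0.
         (\<exists>x \<eta> u \<tau>. hybrid_solution f g k V Q a T N' \<theta> x \<eta> u \<tau> \<and> x 0 = x0 \<and> \<eta> 0 = \<eta>0) \<and>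
         (\<forall>x \<eta> u \<tau>. hybrid_solution f g k V Q a T N' \<theta> x \<eta> u \<tau> \<and> x 0 = x0 \<and> \<eta> 0 = \<eta>0 \<longrightarrow>
            (\<forall>t\<ge>0. \<exists>i. t < \<tau> i) \<and>
            (\<forall>t\<ge>0. norm (x t) \<le> M' \<theta> \<eta>0 * exp (- \<omega> \<theta> * t) * norm x0)))"
proof -
  have fc: "\<And>\<eta>. continuous_on UNIV (\<lambda>x. f x (k \<eta> x))"
    and gc: "\<And>\<eta>. continuous_on UNIV (\<lambda>x. g x (k \<eta> x))"
    using feedback_lipschitz_on_balls[OF k_smooth f_smooth] feedback_lipschitz_on_balls[OF k_smooth g_smooth]
    by (auto intro: lipschitz_on_balls_imp_continuous_on)
  have F: "lipschitz_on_balls (closed_loop f g k \<theta> \<eta>)" for \<theta> \<eta>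
    by (rule closed_loop_lipschitz_on_balls[OF f_smooth g_smooth k_smooth])
  have F0: "closed_loop f g k \<theta> \<eta> 0 = 0" for \<theta> \<eta>
    using k_zero f_zero g_zero by (simp add: closed_loop_def)
  have Vc: "continuous_on UNIV (V \<eta>)" for \<eta>
    using V_cont continuous_on_section[of UNIV UNIV V \<eta>] by simp
  have Vb: "bounded {x. V \<eta> x \<le> c}" for \<eta> c
  proof -
    have "compact {x. V \<eta> x \<le> max c 1}"
      using V_pos unfolding radially_unbounded_def by simp
    then show ?thesis
      by (rule bounded_subset[OF compact_imp_bounded]) auto
  qed
  have a_nz: "0 < a \<xi>" if "\<xi> \<noteq> 0" for \<xi>
    using a_pos that by (simp add: positive_definite_def)
  have start: "V \<eta> \<xi> < Q \<eta> \<xi> + a \<xi>" if "\<xi> \<noteq> 0" for \<eta> \<xi>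
  proof -
    have "V \<eta> \<xi> \<le> Q \<eta> \<xi>"
      using v[rule_format, of "{\<eta>}"] by auto
    then show ?thesis
      using a_nz[OF that] by linarith
  qed
  obtain A0 where A0: "\<And>x. x \<noteq> 0 \<Longrightarrow> a x / (norm x)\<^sup>2 \<le> A0"
    using a_sup unfolding bdd_above_def by auto
  define A where "A = max A0 0"
  have A: "0 \<le> A" "a x \<le> A * (norm x)\<^sup>2" for x
  proof -
    show "0 \<le> A"
      by (simp add: A_def)
    show "a x \<le> A * (norm x)\<^sup>2"
    proof (cases "x = 0")
      case True
      then show ?thesis
        using a_pos by (simp add: positive_definite_def)
    next
      case False
      then have "a x / (norm x)\<^sup>2 \<le> A"
        using A0[OF False] by (simp add: A_def)
      then show ?thesis
        using False by (simp add: divide_simps)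
    qed
  qed
  have N'0: "0 < N'"
    using N'_gt by simp
  have exists: "\<exists>x \<eta> u \<tau>. hybrid_solution f g k V Q a T N' \<theta> x \<eta> u \<tau> \<and> x 0 = x0 \<and> \<eta> 0 = \<eta>0"
    for \<theta> x0 \<eta>0
    by (rule hybrid_solution_exists[OF fc gc F F0 Vc Vb start T_pos N'0])
  have "\<exists>B>0. \<forall>x \<eta> u \<tau>. hybrid_solution f g k V Q a T N' \<theta> x \<eta> u \<tau> \<and> \<eta> 0 = \<eta>0 \<longrightarrow>
      (\<forall>t\<ge>0. \<exists>i. t < \<tau> i) \<and> (\<forall>t\<ge>0. norm (x t) \<le> B * exp (- \<omega> \<theta> * t) * norm (x 0))" for \<theta> \<eta>0
  proof -
    \<comment> \<open>The error never grows, so all estimates lie in a ball depending on \<open>\<theta>\<close> and \<open>\<eta>0\<close> only.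
      Compactness of this ball makes the constants independent of \<open>x0\<close>.\<close>
    obtain K1 K2 where K: "0 < K1" "K1 < K2" and
      VQ: "\<And>\<eta> x. \<eta> \<in> cball \<theta> (norm (\<eta>0 - \<theta>)) \<Longrightarrow> K1 * (norm x)\<^sup>2 \<le> V \<eta> x \<and> Q \<eta> x \<le> K2 * (norm x)\<^sup>2"
      using v[rule_format, of "cball \<theta> (norm (\<eta>0 - \<theta>))"] by auto
    \<comment> \<open>Growth of the norm over one sampling interval: \<open>K1 |x t|\<^sup>2 \<le> V \<le> Q + a \<le> (K2 + A) |x (\<tau> i)|\<^sup>2\<close>.\<close>
    define C where "C = sqrt ((K2 + A) / K1)"
    have C: "1 \<le> C" "C\<^sup>2 = (K2 + A) / K1"
      using K A(1) by (simp_all add: C_def divide_simps)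
    \<comment> \<open>The factor \<open>C ^ N\<close> pays for the transient of at most \<open>N\<close> intervals, and the exponential for the
      delay \<open>\<tau> N \<le> N T\<close>. The maximum covers times before \<open>\<tau> N\<close>, where (iv) does not apply.\<close>
    define B where "B = max 1 (M \<theta>) * C ^ N * exp (\<omega> \<theta> * (real N * T))"
    have B: "0 < B"
      using C(1) by (simp add: B_def)
    have "(\<forall>t\<ge>0. \<exists>i. t < \<tau> i) \<and> (\<forall>t\<ge>0. norm (x t) \<le> B * exp (- \<omega> \<theta> * t) * norm (x 0))"
      if hyb: "hybrid_solution f g k V Q a T N' \<theta> x \<eta> u \<tau>" and init: "\<eta> 0 = \<eta>0" for x \<eta> u \<tau>
    proof -
      have S: "sampled_loop f g k \<theta> x u \<tau> (\<lambda>i. \<eta> (\<tau> i))"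
        using hyb by (simp add: hybrid_solution_iff)
      have \<eta>_ball: "\<eta> (\<tau> i) \<in> cball \<theta> (norm (\<eta>0 - \<theta>))" for i
        using hybrid_solution_estimate_error_antimono[OF hyb fc gc T_pos N'0, of 0 i]
          sampled_loopD(1)[OF S] init by (simp add: dist_norm norm_minus_commute)
      have step: "norm (x t) \<le> C * norm (x (\<tau> i))" if t: "t \<in> {\<tau> i..\<tau> (Suc i)}" for i t
      proof (cases "x (\<tau> i) = 0")
        case True
        then show ?thesis
          using hybrid_solution_rest(1)[OF hyb F F0 True t] by simp
      next
        case False
        have "K1 * (norm (x t))\<^sup>2 \<le> V (\<eta> (\<tau> i)) (x t)"
          using VQ[OF \<eta>_ball] by blast
        also have "\<dots> \<le> Q (\<eta> (\<tau> i)) (x (\<tau> i)) + a (x (\<tau> i))"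
          by (rule hybrid_solution_level_bound[OF hyb Vc start[OF False] False t])
        also have "\<dots> \<le> K2 * (norm (x (\<tau> i)))\<^sup>2 + A * (norm (x (\<tau> i)))\<^sup>2"
          using VQ[OF \<eta>_ball] A(2) by (intro add_mono) blast+
        also have "\<dots> = K1 * (C * norm (x (\<tau> i)))\<^sup>2"
          using K(1) by (simp add: power_mult_distrib C(2) distrib_right)
        finally have "(norm (x t))\<^sup>2 \<le> (C * norm (x (\<tau> i)))\<^sup>2"
          using K(1) by simp
        then show ?thesis
          by (rule power2_le_imp_le) (use C(1) in simp)
      qed
      have transient: "norm (x t) \<le> C ^ n * norm (x 0)" if "t \<in> {0..\<tau> n}" for n t
        using that
      proof (induction n arbitrary: t)
        case 0
        then show ?case
          using sampled_loopD(1)[OF S] by simp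
      next
        case (Suc n)
        show ?case
        proof (cases "t \<le> \<tau> n")
          case True
          then have "norm (x t) \<le> C ^ n * norm (x 0)"
            using Suc by simp
          also have "\<dots> \<le> C ^ Suc n * norm (x 0)"
            using C(1) by (intro mult_right_mono power_increasing) auto
          finally show ?thesis .
        next
          case False
          then have "norm (x t) \<le> C * norm (x (\<tau> n))"
            using Suc.prems by (intro step) simp
          also have "\<dots> \<le> C * (C ^ n * norm (x 0))"
            using C(1) sampled_loop_times(2)[OF S] by (intro mult_left_mono Suc.IH) auto
          finally show ?thesis
            by (simp add: mult.assoc)
        qed
      qed
      show ?thesis
      proof (cases "x 0 = 0")
        case True
        have "x (\<tau> i) = 0" for i
          using transient[of "\<tau> i" i] sampled_loop_times(2)[OF S, of i] True by simp
        then have "\<tau> (Suc i) = \<tau> i + T" for i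
          by (rule hybrid_solution_rest(2)[OF hyb F F0])
        then have unbounded: "\<exists>i. t < \<tau> i" for t
          using eventually_equidistant_unbounded[of 0 \<tau> T t] T_pos by blast
        have "x t = 0" if "0 \<le> t" for t
        proof -
          obtain i where "t < \<tau> i"
            using unbounded by blast
          then show ?thesis
            using transient[of t i] that True by simp
        qed
        then show ?thesis
          using unbounded True by simp
      next
        case False
        have "\<eta> (\<tau> N) = \<theta>"
          by (rule finite_time_identification[OF hyb fc gc T_pos N'_gt iii False])
        then have \<eta>_eq: "\<eta> (\<tau> i) = \<theta>" if "N \<le> i" for i
          using hybrid_solution_estimate_error_antimono[OF hyb fc gc T_pos N'0 that] by simp
        have "\<tau> (Suc i) = \<tau> i + T" if "N \<le> i" for i
        proof (rule hybrid_solution_step_eq[OF hyb])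
          show "ereal (\<tau> i + T) \<le> trigger_time f g k V Q a T \<theta> (\<eta> (\<tau> i)) (\<tau> i) (x (\<tau> i))"
            unfolding \<eta>_eq[OF that]
            using i_gas i_bound a_nz by (intro certainty_equivalence_no_trigger F) auto
        qed
        then have unbounded: "\<exists>i\<ge>N. t < \<tau> i" for t
          by (rule eventually_equidistant_unbounded[OF _ T_pos])
        have \<tau>N: "0 \<le> \<tau> N" "\<tau> N \<le> real N * T"
          by (rule sampled_loop_times(2)[OF S], rule hybrid_solution_times_le[OF hyb])
        have "norm (x t) \<le> B * exp (- \<omega> \<theta> * t) * norm (x 0)" if t: "0 \<le> t" for t
        proof (cases "t \<le> \<tau> N")
          case True
          have "1 \<le> exp (\<omega> \<theta> * (real N * T - t))"
            using True \<tau>N iv_pos by (simp add: less_imp_le)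
          then have "1 * 1 \<le> max 1 (M \<theta>) * exp (\<omega> \<theta> * (real N * T - t))"
            by (intro mult_mono) auto
          then have "1 * (C ^ N * norm (x 0)) \<le>
              max 1 (M \<theta>) * exp (\<omega> \<theta> * (real N * T - t)) * (C ^ N * norm (x 0))"
            using C(1) by (intro mult_right_mono) auto
          also have "\<dots> = B * exp (- \<omega> \<theta> * t) * norm (x 0)"
            by (simp add: B_def right_diff_distrib exp_diff exp_minus divide_simps)
          finally show ?thesis
            using transient[of t N] t True by simp
        next
          case False
          obtain z where z: "ode_solution (closed_loop f g k \<theta> \<theta>) {0..} z" "z 0 = x (\<tau> N)"
            using i_gas unfolding globally_asymptotically_stable_def by blast
          obtain i where i: "N \<le> i" "t < \<tau> i"
            using unbounded by blast
          have "x t = z (t - \<tau> N)"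
            by (rule hybrid_solution_follows_nominal[OF hyb F z \<eta>_eq, of t "i - N"])
              (use i False in auto)
          then have "norm (x t) \<le> M \<theta> * exp (- \<omega> \<theta> * (t - \<tau> N)) * norm (x (\<tau> N))"
            using iv[rule_format, OF z(1), of "t - \<tau> N"] z(2) False by simp
          also have "\<dots> \<le> max 1 (M \<theta>) * exp (\<omega> \<theta> * (real N * T - t)) * (C ^ N * norm (x 0))"
          proof (intro mult_mono)
            show "exp (- \<omega> \<theta> * (t - \<tau> N)) \<le> exp (\<omega> \<theta> * (real N * T - t))"
              using mult_left_mono[OF \<tau>N(2), of "\<omega> \<theta>"] iv_pos
              by (simp add: algebra_simps less_imp_le)
            show "norm (x (\<tau> N)) \<le> C ^ N * norm (x 0)"
              using transient \<tau>N(1) by simp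
          qed auto
          also have "\<dots> = B * exp (- \<omega> \<theta> * t) * norm (x 0)"
            by (simp add: B_def right_diff_distrib exp_diff exp_minus divide_simps)
          finally show ?thesis .
        qed
        then show ?thesis
          using unbounded by blast
      qed
    qed
    then show ?thesis
      using B by blast
  qed
  then obtain M' where M': "\<And>\<theta> \<eta>0. 0 < M' \<theta> \<eta>0" and
    estimate: "\<And>\<theta> \<eta>0 x \<eta> u \<tau>. hybrid_solution f g k V Q a T N' \<theta> x \<eta> u \<tau> \<Longrightarrow> \<eta> 0 = \<eta>0 \<Longrightarrow>
      (\<forall>t\<ge>0. \<exists>i. t < \<tau> i) \<and>
      (\<forall>t\<ge>0. norm (x t) \<le> M' \<theta> \<eta>0 * exp (- \<omega> \<theta> * t) * norm (x 0))"
    by metis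
  show ?thesis
    using M' exists estimate by (intro exI[of _ M']) blast
qed

end
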